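(* Let $p\ge 3$ be a prime. Let $\mathbf G$ be one of $\mathbf{SL}_2$, $\mathbf{SL}_k$ with $k\ge 3$, or $\mathbf{Sp}_{2k}$ with $k\ge 2$, and let $h(\mathbf{SL}_2,p)=\frac12(p-1)$, $h(\mathbf{SL}_k,p)=p^{k-1}-p^{k-2}$ for $k\ge 3$, and $h(\mathbf{Sp}_{2k},p)=\frac12(p-1)p^{k-1}$ for $k\ge 2$. Then the degree of any non-trivial continuous representation of the compact group $\mathbf G(\mathbb Z_p)$ is at least $h(\mathbf G,p)$.
   Context: $\mathbb Z_p$ is the ring of $p$-adic integers, and $\mathbf G(\mathbb Z_p)$ carries its profinite ($p$-adic) topology. Representations are finite-dimensional and complex; a representation is non-trivial if it is not the constant homomorphism to the identity. For a commutative ring $R$, $\mathbf{SL}_k(R)$ is the group of $k\times k$ matrices over $R$ of determinant $1$, and $\mathbf{Sp}_{2k}(R)=\{A\in \mathrm{GL}_{2k}(R): AJA^T=J\}$, where $J=\begin{pmatrix}0&I_k\\-I_k&0\end{pmatrix}$. *)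

theory Defs
  imports
    "HOL-Analysis.Analysis"
    "HOL-Algebra.Group"
    "Berlekamp_Zassenhaus.Finite_Field"
begin

section \<open>The ring of \<open>p\<close>-adic integers\<close>

text \<open>
  The prime \<open>p\<close> is the cardinality of the index type \<open>'p\<close>, and the ring is the
  inverse limit of the rings of integers modulo \<open>p ^ n\<close>: an element is a compatible
  sequence whose \<open>n\<close>-th entry is the representative in \<open>{0..<p ^ n}\<close> of its residue
  modulo \<open>p ^ n\<close>.
\<close>

typedef (overloaded) ('p::prime_card) padic_int =
  "{x :: nat \<Rightarrow> int. \<forall>n. x n \<in> {0..<int CARD('p) ^ n} \<and>
      x (Suc n) mod int CARD('p) ^ n = x n}"
  morphisms padic_residue Abs_padic_int
  by (rule exI[of _ "\<lambda>_. 0"]) (simp add: prime_card_int prime_gt_0_int)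

setup_lifting type_definition_padic_int

lemma mod_padic_pow_Suc:
  "(a mod int CARD('p::prime_card) ^ Suc n) mod int CARD('p) ^ n = a mod int CARD('p) ^ n"
  by (rule mod_mod_cancel) simp

lemma padic_pow_pos: "int CARD('p::prime_card) ^ n > 0"
  by (simp add: prime_card_int prime_gt_0_int)

lemma padic_pow_Suc_gt_1: "int CARD('p::prime_card) ^ Suc n > 1"
  using prime_gt_1_int[OF prime_card_int[where 'a = 'p]] one_less_power zero_less_Suc by blast

lemma compatible_modI:
  fixes f :: "nat \<Rightarrow> int"
  assumes "f (Suc n) mod int CARD('p::prime_card) ^ n = f n mod int CARD('p) ^ n"
  shows "f n mod int CARD('p) ^ n \<in> {0..<int CARD('p) ^ n} \<and>
    f (Suc n) mod int CARD('p) ^ Suc n mod int CARD('p) ^ n = f n mod int CARD('p) ^ n"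
proof -
  have "f (Suc n) mod int CARD('p) ^ Suc n mod int CARD('p) ^ n = f n mod int CARD('p) ^ n"
    using assms mod_padic_pow_Suc[where 'p = 'p, of "f (Suc n)" n] by (rule trans[rotated])
  then show ?thesis
    using pos_mod_bound[OF padic_pow_pos[where 'p = 'p and n = n]]
      pos_mod_sign[OF padic_pow_pos[where 'p = 'p and n = n]] by simp
qed

instantiation padic_int :: (prime_card) comm_ring_1
begin

lift_definition zero_padic_int :: "'a padic_int"
  is "\<lambda>n. 0 mod int CARD('a) ^ n"
  subgoal for n by (rule compatible_modI[where f = "\<lambda>_. 0"]) (rule refl)
  done

lift_definition one_padic_int :: "'a padic_int"
  is "\<lambda>n. 1 mod int CARD('a) ^ n"
  subgoal for n by (rule compatible_modI[where f = "\<lambda>_. 1"]) (rule refl)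
  done

lift_definition plus_padic_int :: "'a padic_int \<Rightarrow> 'a padic_int \<Rightarrow> 'a padic_int"
  is "\<lambda>x y n. (x n + y n) mod int CARD('a) ^ n"
  subgoal for x y n by (rule compatible_modI[where f = "\<lambda>n. x n + y n"]) (rule mod_add_cong; metis mod_mod_trivial)
  done

lift_definition minus_padic_int :: "'a padic_int \<Rightarrow> 'a padic_int \<Rightarrow> 'a padic_int"
  is "\<lambda>x y n. (x n - y n) mod int CARD('a) ^ n"
  subgoal for x y n by (rule compatible_modI[where f = "\<lambda>n. x n - y n"]) (rule mod_diff_cong; metis mod_mod_trivial)
  done

lift_definition times_padic_int :: "'a padic_int \<Rightarrow> 'a padic_int \<Rightarrow> 'a padic_int"
  is "\<lambda>x y n. (x n * y n) mod int CARD('a) ^ n"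
  subgoal for x y n by (rule compatible_modI[where f = "\<lambda>n. x n * y n"]) (rule mod_mult_cong; metis mod_mod_trivial)
  done

lift_definition uminus_padic_int :: "'a padic_int \<Rightarrow> 'a padic_int"
  is "\<lambda>x n. (- x n) mod int CARD('a) ^ n"
  subgoal for x n by (rule compatible_modI[where f = "\<lambda>n. - x n"]) (rule mod_minus_cong; metis mod_mod_trivial)
  done

instance
proof
  note rep = zero_padic_int.rep_eq one_padic_int.rep_eq plus_padic_int.rep_eq
    minus_padic_int.rep_eq uminus_padic_int.rep_eq times_padic_int.rep_eq
  fix a b c :: "'a padic_int"
  have eqI: "x = y" if "\<And>n. padic_residue x n = padic_residue y n" for x y :: "'a padic_int"
    using that by (auto simp: padic_residue_inject[symmetric])
  have res: "padic_residue x n mod int CARD('a) ^ n = padic_residue x n" for x :: "'a padic_int" and n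
    using padic_residue[of x] by (auto intro: mod_pos_pos_trivial)
  show "a * b * c = a * (b * c)"
    by (rule eqI) (simp only: rep mod_mult_left_eq mod_mult_right_eq mult.assoc)
  show "a * b = b * a"
    by (rule eqI) (simp only: rep mult.commute)
  show "1 * a = a"
    by (rule eqI) (simp only: rep mod_mult_left_eq mult_1 res)
  show "a + b + c = a + (b + c)"
    by (rule eqI) (simp only: rep mod_add_left_eq mod_add_right_eq add.assoc)
  show "a + b = b + a"
    by (rule eqI) (simp only: rep add.commute)
  show "0 + a = a"
    by (rule eqI) (simp only: rep mod_add_left_eq add_0 res)
  show "- a + a = 0"
    by (rule eqI) (simp only: rep mod_add_left_eq left_minus)
  show "a - b = a + - b"
    by (rule eqI) (simp only: rep mod_add_right_eq diff_conv_add_uminus)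
  show "(a + b) * c = a * c + b * c"
    by (rule eqI) (simp only: rep mod_mult_left_eq mod_add_left_eq mod_add_right_eq distrib_right)
  show "(0::'a padic_int) \<noteq> 1"
  proof
    assume "(0::'a padic_int) = 1"
    then have "padic_residue (0::'a padic_int) (Suc 0) = padic_residue (1::'a padic_int) (Suc 0)" by simp
    then show False
      using padic_pow_Suc_gt_1[where 'p = 'a, of 0]
      by (simp add: zero_padic_int.rep_eq one_padic_int.rep_eq)
  qed
qed

end

text \<open>
  The \<open>p\<close>-adic topology: the sets of all \<open>y\<close> congruent to \<open>x\<close> modulo \<open>p ^ n\<close> form
  a neighbourhood basis at \<open>x\<close>.
\<close>

instantiation padic_int :: (prime_card) topological_space
begin

definition open_padic_int :: "'a padic_int set \<Rightarrow> bool" where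
  "open_padic_int U \<longleftrightarrow> (\<forall>x\<in>U. \<exists>n. {y. padic_residue y n = padic_residue x n} \<subseteq> U)"

instance
proof
  show "open (UNIV :: 'a padic_int set)" by (simp add: open_padic_int_def)
next
  fix S T :: "'a padic_int set"
  assume S: "open S" and T: "open T"
  have le: "padic_residue y m = padic_residue x m" if "padic_residue y n = padic_residue x n" "m \<le> n"
    for x y :: "'a padic_int" and m n
    using that(2,1)
  proof (induction n rule: dec_induct)
    case (step n)
    have "padic_residue z (Suc n) mod int CARD('a) ^ n = padic_residue z n" for z :: "'a padic_int"
      using padic_residue[of z] by blast
    then have "padic_residue y n = padic_residue x n"
      by (metis step.prems)
    then show ?case by (rule step.IH)
  qed simp
  show "open (S \<inter> T)"
    unfolding open_padic_int_def
  proof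
    fix x assume x: "x \<in> S \<inter> T"
    obtain m where m: "{y. padic_residue y m = padic_residue x m} \<subseteq> S"
      using S x unfolding open_padic_int_def by blast
    obtain n where n: "{y. padic_residue y n = padic_residue x n} \<subseteq> T"
      using T x unfolding open_padic_int_def by blast
    have "{y. padic_residue y (max m n) = padic_residue x (max m n)} \<subseteq> S \<inter> T"
    proof
      fix y :: "'a padic_int"
      assume "y \<in> {y. padic_residue y (max m n) = padic_residue x (max m n)}"
      then have eq: "padic_residue y (max m n) = padic_residue x (max m n)"
        by (rule CollectD)
      have "padic_residue y m = padic_residue x m" "padic_residue y n = padic_residue x n"
        by (rule le[OF eq max.cobounded1], rule le[OF eq max.cobounded2])
      then show "y \<in> S \<inter> T" using m n by blast
    qed
    then show "\<exists>n. {y. padic_residue y n = padic_residue x n} \<subseteq> S \<inter> T" by (rule exI)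
  qed
next
  fix K :: "'a padic_int set set"
  assume K: "\<forall>S\<in>K. open S"
  show "open (\<Union>K)"
    unfolding open_padic_int_def
  proof
    fix x assume "x \<in> \<Union>K"
    then obtain S where S: "S \<in> K" "x \<in> S" by (rule UnionE)
    with K obtain n where "{y. padic_residue y n = padic_residue x n} \<subseteq> S"
      unfolding open_padic_int_def by blast
    with S show "\<exists>n. {y. padic_residue y n = padic_residue x n} \<subseteq> \<Union>K" by blast
  qed
qed

end


section \<open>Matrix groups over a commutative ring\<close>

definition GL :: "('a::comm_ring_1 ^ 'n ^ 'n) monoid" where
  "GL = \<lparr>carrier = {A. invertible A}, mult = (**), one = mat 1\<rparr>"

definition SL :: "('a::comm_ring_1 ^ 'n ^ 'n) monoid" where
  "SL = GL\<lparr>carrier := {A. det A = 1}\<rparr>"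

text \<open>
  Matrices of size \<open>2k\<close> are indexed by \<open>'k + 'k\<close> with \<open>CARD('k) = k\<close>; \<open>Inl\<close> and \<open>Inr\<close>
  address the first and the second block.
\<close>

definition symplectic_J :: "'a::comm_ring_1 ^ ('k::finite + 'k) ^ ('k + 'k)" where
  "symplectic_J = (\<chi> i j. case (i, j) of
      (Inl a, Inr b) \<Rightarrow> (mat 1 :: 'a ^ 'k ^ 'k) $ a $ b
    | (Inr a, Inl b) \<Rightarrow> - (mat 1 :: 'a ^ 'k ^ 'k) $ a $ b
    | _ \<Rightarrow> 0)"

definition Sp :: "('a::comm_ring_1 ^ ('k::finite + 'k) ^ ('k + 'k)) monoid" where
  "Sp = GL\<lparr>carrier := {A \<in> carrier GL. A ** symplectic_J ** transpose A = symplectic_J}\<rparr>"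


section \<open>Representations\<close>

text \<open>A complex representation of degree \<open>CARD('d)\<close>, in matrix form.\<close>

definition continuous_representation ::
    "('a::topological_space ^ 'n ^ 'n) monoid \<Rightarrow> ('a ^ 'n ^ 'n \<Rightarrow> complex ^ 'd ^ 'd) \<Rightarrow> bool" where
  "continuous_representation G \<rho> \<longleftrightarrow> \<rho> \<in> hom G GL \<and> continuous_on (carrier G) \<rho>"

definition nontrivial_representation ::
    "('a ^ 'n ^ 'n) monoid \<Rightarrow> ('a ^ 'n ^ 'n \<Rightarrow> complex ^ 'd ^ 'd) \<Rightarrow> bool" where
  "nontrivial_representation G \<rho> \<longleftrightarrow> (\<exists>A\<in>carrier G. \<rho> A \<noteq> mat 1)"

end

theory Submission
  imports Defs
begin

text \<open>
  The degree of \<open>\<rho>\<close> is bounded below by the number of characters by which a suitable abelian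
  unipotent subgroup \<open>N\<close> acts, and that number is large because the normaliser of \<open>N\<close> permutes
  these characters.

  In each group \<open>N\<close> is the image of some power of \<open>\<int>\<^sub>p\<close>, so \<open>\<rho>\<close> restricts to a homomorphism
  \<open>\<Phi>\<close> from that additive group to complex matrices. Matrices close to the identity contain no
  subgroup except the trivial one (\<open>no_small_subgroup\<close>), so by continuity \<open>\<Phi>\<close> is trivial on the
  vectors divisible by some power of \<open>p\<close>. If \<open>n\<close> is chosen such that \<open>\<Phi>\<close> is trivial on multiples
  of \<open>p\<^sup>n\<^sup>+\<^sup>1\<close> but not on multiples of \<open>p\<^sup>n\<close>, then the values on multiples of \<open>p\<^sup>n\<close> form a
  non-trivial representation of a vector space over the field with \<open>p\<close> elements (\<open>exact_level\<close>).
  Fourier analysis over that finite group decomposes it: its spectrum is the set of vectors \<open>a\<close> for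
  which some non-zero vector is multiplied by the character \<open>v \<mapsto> \<psi> (a \<bullet> v)\<close>. Eigenvectors for
  different \<open>a\<close> are linearly independent (\<open>card_spectrum_le\<close>), so the spectrum has at most
  as many elements as the degree. Because only one layer modulo \<open>p\<close> is used, the conductor of the
  original characters never enters.

  A group element normalising \<open>N\<close> moves the spectrum by the dual of its action on \<open>N\<close>
  (\<open>spectrum_dual\<close>). Two kinds of elements suffice. Elementary matrices add arbitrary multiples of a
  distinguished non-zero coordinate of \<open>a\<close> to other coordinates, which makes those free. A
  diagonal matrix multiplies the distinguished coordinate by an arbitrary non-zero square, which gives
  it at least \<open>(p - 1) / 2\<close> values.

  \<^item> In \<open>SL\<^sub>k\<close> take for \<open>N\<close> the matrices that differ from the identity only in the off-diagonal
    entries of one column. For \<open>k = 2\<close> the diagonal matrices give \<open>(p - 1) / 2\<close> characters. For \<open>k \<ge> 3\<close> a second coordinate can be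
    made non-zero and used to change the distinguished one as well, so all its \<open>p - 1\<close> non-zero values
    occur, each with \<open>k - 2\<close> free coordinates (\<open>SL_degree\<close>).
  \<^item> In \<open>Sp\<^sub>2\<^sub>k\<close> take for \<open>N\<close> the upper unipotent matrices whose symmetric block is supported on one row
    and the column with the same index. There are \<open>k - 1\<close> free coordinates, and the distinguished one is
    scaled by squares (\<open>Sp_degree\<close>).

  It remains to see that \<open>\<rho>\<close> is non-trivial on \<open>N\<close>. This is a matter of generators over a
  local ring: \<open>SL\<^sub>k\<close> is generated by the one-column matrices, by Gaussian elimination
  (\<open>SL_generated_by_elementary\<close>), and \<open>Sp\<^sub>2\<^sub>k\<close> by transvections along unimodular vectors
  (\<open>Sp_generated_by_transvections\<close>), all of which with the same parameter are conjugate.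
\<close>

section \<open>Characters of elementary abelian groups and their simultaneous eigenvectors\<close>

text \<open>
  The character group of the integers modulo \<open>p\<close> is cyclic; this is the generator that sends \<open>1\<close>
  to \<open>exp (2 \<pi> \<i> / p)\<close>, and every other character is \<open>x \<mapsto> add_char (a * x)\<close>.
\<close>

definition add_char :: "'p::prime_card mod_ring \<Rightarrow> complex" where
  "add_char x = cis (2 * pi * real_of_int (to_int_mod_ring x) / real CARD('p))"

lemma cis_two_pi_int: "cis (2 * pi * of_int k) = 1"
  using cis_multiple_2pi[of "of_int k"] by simp

lemma cis_mod_period:
  assumes "q > 0"
  shows "cis (2 * pi * real_of_int (k mod q) / real_of_int q) = cis (2 * pi * real_of_int k / real_of_int q)"
proof -
  have "real_of_int k = real_of_int q * real_of_int (k div q) + real_of_int (k mod q)"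
    by (metis mult_div_mod_eq of_int_add of_int_mult)
  then have "2 * pi * real_of_int k / real_of_int q
    = 2 * pi * real_of_int (k div q) + 2 * pi * real_of_int (k mod q) / real_of_int q"
    using assms by (simp add: field_simps)
  then show ?thesis
    by (simp add: cis_two_pi_int flip: cis_mult)
qed

lemma add_char_add: "add_char (x + y) = add_char x * add_char y"
  for x y :: "'p::prime_card mod_ring"
proof -
  have "add_char (x + y) =
      cis (2 * pi * real_of_int (to_int_mod_ring x + to_int_mod_ring y) / real CARD('p))"
    using cis_mod_period[of "int CARD('p)" "to_int_mod_ring x + to_int_mod_ring y"]
    by (simp add: add_char_def to_int_mod_ring_add)
  then show ?thesis
    by (simp add: add_char_def cis_mult add_divide_distrib distrib_left)
qed

lemma add_char_0 [simp]: "add_char 0 = 1"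
  by (simp add: add_char_def)

lemma add_char_1_neq_1: "add_char (1 :: 'p::prime_card mod_ring) \<noteq> 1"
proof
  assume "add_char (1 :: 'p mod_ring) = 1"
  moreover have "to_int_mod_ring (1 :: 'p mod_ring) = 1"
    by simp
  ultimately have "cis (2 * pi / real CARD('p)) = 1"
    by (simp add: add_char_def)
  then have "cos (2 * pi / real CARD('p)) = 1"
    by (simp add: complex_eq_iff)
  then obtain k :: int where "2 * pi / real CARD('p) = real_of_int k * 2 * pi"
    by (auto simp: cos_one_2pi_int)
  then have "1 = real_of_int k * real CARD('p)"
    by (simp add: field_simps)
  then have "1 = k * int CARD('p)"
    by (metis of_int_1 of_int_eq_iff of_int_mult of_int_of_nat_eq)
  then have "int CARD('p) dvd 1"
    by (metis dvd_triv_right)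
  then show False
    using prime_card_int[where 'a = 'p] not_prime_unit by blast
qed

definition dot :: "'a::comm_ring_1 ^ 'm \<Rightarrow> 'a ^ 'm \<Rightarrow> 'a" where
  "dot a v = (\<Sum>i\<in>UNIV. a $ i * v $ i)"

lemma dot_add_right: "dot a (u + v) = dot a u + dot a v"
  by (simp add: dot_def distrib_left sum.distrib)

lemma dot_diff_left: "dot (a - b) v = dot a v - dot b v"
  by (simp add: dot_def left_diff_distrib sum_subtractf)

lemma dot_diff_right: "dot a (u - v) = dot a u - dot a v"
  by (simp add: dot_def right_diff_distrib sum_subtractf)

lemma dot_0 [simp]: "dot 0 v = 0" "dot a 0 = 0"
  by (simp_all add: dot_def)

lemma dot_commute: "dot a v = dot v a"
  by (simp add: dot_def mult.commute)

lemma dot_axis: "dot a (axis i c) = a $ i * c"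
proof -
  have "(\<Sum>l\<in>UNIV. a $ l * axis i c $ l) = (\<Sum>l\<in>UNIV. if l = i then a $ i * c else 0)"
    by (rule sum.cong) (auto simp: axis_def)
  then show ?thesis by (simp add: dot_def)
qed

text \<open>
  Translating the summation variable by a vector on which the character has the value
  \<open>add_char 1 \<noteq> 1\<close> multiplies the sum by that value, so the sum vanishes.
\<close>

lemma sum_add_char_dot:
  fixes a :: "('p::prime_card mod_ring) ^ 'm"
  shows "(\<Sum>v\<in>UNIV. add_char (dot a v)) = (if a = 0 then of_nat (CARD('p mod_ring) ^ CARD('m)) else 0)"
proof (cases "a = 0")
  case True
  then show ?thesis by simp
next
  case False
  then obtain i where i: "a $ i \<noteq> 0"
    by (auto simp: vec_eq_iff)
  define w where "w = axis i (1 / a $ i)"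
  have w: "dot a w = 1"
    using i by (simp add: w_def dot_axis)
  have "(\<Sum>v\<in>UNIV. add_char (dot a v)) = (\<Sum>v\<in>UNIV. add_char (dot a (v + w)))"
    by (rule sum.reindex_bij_witness[of _ "\<lambda>v. v + w" "\<lambda>v. v - w"]) auto
  also have "\<dots> = add_char (1 :: 'p mod_ring) * (\<Sum>v\<in>UNIV. add_char (dot a v))"
    by (simp add: dot_add_right w add_char_add sum_distrib_left mult.commute)
  finally have "(add_char (1 :: 'p mod_ring) - 1) * (\<Sum>v\<in>UNIV. add_char (dot a v)) = 0"
    by (simp add: algebra_simps)
  then show ?thesis
    using add_char_1_neq_1[where 'p = 'p] False by simp
qed

text \<open>
  A representation of the elementary abelian \<open>p\<close>-group of vectors over the field with \<open>p\<close> elements.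
  The bilinear form \<^const>\<open>dot\<close> identifies this group with its character group, so characters are
  indexed by vectors \<open>a\<close>.
\<close>

locale elementary_rep =
  fixes R :: "('p::prime_card mod_ring) ^ 'm \<Rightarrow> complex ^ 'd ^ 'd"
  assumes R_0: "R 0 = mat 1"
    and R_add: "R (u + v) = R u ** R v"
begin

definition eigen :: "('p mod_ring) ^ 'm \<Rightarrow> complex ^ 'd \<Rightarrow> bool" where
  "eigen a x \<longleftrightarrow> (\<forall>v. R v *v x = add_char (dot a v) *s x)"

definition spectrum :: "(('p mod_ring) ^ 'm) set" where
  "spectrum = {a. \<exists>x. x \<noteq> 0 \<and> eigen a x}"

text \<open>
  Up to the factor \<open>p ^ m\<close>, with \<open>m\<close> the number of coordinates, this is the projection to the space
  of eigenvectors with character \<open>a\<close>. Leaving the factor out avoids divisions.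
\<close>

definition proj :: "('p mod_ring) ^ 'm \<Rightarrow> complex ^ 'd \<Rightarrow> complex ^ 'd" where
  "proj a x = (\<Sum>v\<in>UNIV. add_char (- dot a v) *s (R v *v x))"

lemma eigen_proj: "eigen a (proj a x)"
  unfolding eigen_def
proof
  fix v
  have "R v *v proj a x = (\<Sum>u\<in>UNIV. add_char (- dot a u) *s (R (v + u) *v x))"
    by (simp add: proj_def vec.sum vec.scale R_add matrix_vector_mul_assoc)
  also have "\<dots> = (\<Sum>u\<in>UNIV. (add_char (dot a v) * add_char (- dot a (v + u))) *s (R (v + u) *v x))"
    by (intro sum.cong refl arg_cong2[where f = "(*s)"])
      (simp add: dot_add_right algebra_simps flip: add_char_add)
  also have "\<dots> = (\<Sum>u\<in>UNIV. (add_char (dot a v) * add_char (- dot a u)) *s (R u *v x))"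
    by (rule sum.reindex_bij_witness[of _ "\<lambda>u. u - v" "\<lambda>u. v + u"]) auto
  also have "\<dots> = add_char (dot a v) *s proj a x"
    by (simp add: proj_def vec.scale_sum_right)
  finally show "R v *v proj a x = add_char (dot a v) *s proj a x" .
qed

lemma proj_eigen:
  assumes "eigen b x"
  shows "proj a x = (if a = b then of_nat (CARD('p mod_ring) ^ CARD('m)) *s x else 0)"
proof -
  have "proj a x = (\<Sum>v\<in>UNIV. add_char (dot (b - a) v)) *s x"
    using assms
    by (simp add: proj_def eigen_def vec.scale_sum_left dot_diff_left flip: add_char_add)
  then show ?thesis
    by (auto simp: sum_add_char_dot)
qed

lemma fourier_inversion:
  "(\<Sum>a\<in>UNIV. add_char (dot a v) *s proj a x) = of_nat (CARD('p mod_ring) ^ CARD('m)) *s (R v *v x)"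
proof -
  have "(\<Sum>a\<in>UNIV. add_char (dot a v) *s proj a x)
      = (\<Sum>a\<in>UNIV. \<Sum>u\<in>UNIV. add_char (dot a (v - u)) *s (R u *v x))"
    by (simp add: proj_def vec.scale_sum_right dot_diff_right
        flip: add_char_add)
  also have "\<dots> = (\<Sum>u\<in>UNIV. (\<Sum>a\<in>UNIV. add_char (dot (v - u) a)) *s (R u *v x))"
    by (subst sum.swap) (simp add: vec.scale_sum_left dot_commute[of "v - _"])
  also have "\<dots> = (\<Sum>u\<in>UNIV. if u = v then of_nat (CARD('p mod_ring) ^ CARD('m)) *s (R v *v x) else 0)"
    by (intro sum.cong refl) (auto simp: sum_add_char_dot)
  finally show ?thesis by simp
qed

text \<open>
  Choose an eigenvector for each point of the spectrum. Applying \<open>proj a\<close> to a linear relation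
  between them kills every term except the one that belongs to \<open>a\<close>, so all coefficients are zero.
\<close>

lemma card_spectrum_le: "card spectrum \<le> CARD('d)"
proof -
  define w where "w a = (SOME x. x \<noteq> 0 \<and> eigen a x)" for a
  have w: "w a \<noteq> 0 \<and> eigen a (w a)" if "a \<in> spectrum" for a
    unfolding w_def by (rule someI_ex) (use that in \<open>simp add: spectrum_def\<close>)
  have proj_w: "proj b (w a) = (if b = a then of_nat (CARD('p mod_ring) ^ CARD('m)) *s w a else 0)"
    if "a \<in> spectrum" for a b
    using w[OF that] proj_eigen by auto
  have inj: "inj_on w spectrum"
  proof (rule inj_onI, rule ccontr)
    fix a b assume ab: "a \<in> spectrum" "b \<in> spectrum" "w a = w b" "a \<noteq> b"
    then have "of_nat (CARD('p mod_ring) ^ CARD('m)) *s w a = 0"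
      using proj_w[of a a] proj_w[of b a] by simp
    then show False using w[OF ab(1)] by simp
  qed
  have lin: "proj b (\<Sum>x\<in>A. c x *s g x) = (\<Sum>x\<in>A. c x *s proj b (g x))"
    if "finite A" for A c b and g :: "_ \<Rightarrow> complex ^ 'd"
    using that
    by (induction A rule: finite_induct)
      (simp_all add: proj_def matrix_vector_right_distrib vec.scale vec.scale_right_distrib
        sum.distrib vec.scale_sum_right mult.commute)
  have "vec.independent (w ` spectrum)"
  proof (rule vec.independent_if_scalars_zero)
    show "finite (w ` spectrum)" by simp
    fix c x assume 0: "(\<Sum>x\<in>w ` spectrum. c x *s x) = 0" and "x \<in> w ` spectrum"
    then obtain a where a: "a \<in> spectrum" "x = w a" by blast
    have "0 = proj a 0"
      by (simp add: proj_def)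
    also have "\<dots> = proj a (\<Sum>x\<in>w ` spectrum. c x *s x)"
      by (simp only: 0)
    also have "\<dots> = (\<Sum>b\<in>spectrum. c (w b) *s proj a (w b))"
      by (simp add: lin sum.reindex[OF inj])
    also have "\<dots> = (\<Sum>b\<in>spectrum. if b = a then c x *s (of_nat (CARD('p mod_ring) ^ CARD('m)) *s x) else 0)"
      by (intro sum.cong refl) (auto simp: proj_w a)
    also have "\<dots> = c x *s (of_nat (CARD('p mod_ring) ^ CARD('m)) *s x)"
      using a by simp
    finally show "c x = 0"
      using w[OF a(1)] a(2) by simp
  qed
  then have "card (w ` spectrum) \<le> vec.dim (UNIV :: (complex ^ 'd) set)"
    by (intro vec.independent_card_le_dim) auto
  then show ?thesis
    by (simp only: card_image[OF inj] vec_dim_card)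
qed

text \<open>
  If every character that occurs were trivial on \<open>v\<close>, Fourier inversion at \<open>v\<close> would give the same
  vector as at \<open>0\<close>.
\<close>

lemma spectrum_detects:
  assumes "R v \<noteq> mat 1"
  shows "\<exists>a\<in>spectrum. dot a v \<noteq> 0"
proof (rule ccontr)
  assume "\<not> ?thesis"
  then have *: "dot a v = 0 \<or> proj a x = 0" for a x
    using eigen_proj[of a x] unfolding spectrum_def by auto
  have "R v *v x = x" for x
  proof -
    have eq: "add_char (dot a v) *s proj a x = add_char (dot a 0) *s proj a x" for a
      using *[of a x] by auto
    have "of_nat (CARD('p mod_ring) ^ CARD('m)) *s (R v *v x) = (\<Sum>a\<in>UNIV. add_char (dot a v) *s proj a x)"
      by (simp only: fourier_inversion)
    also have "\<dots> = (\<Sum>a\<in>UNIV. add_char (dot a 0) *s proj a x)"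
      by (intro sum.cong refl eq)
    also have "\<dots> = of_nat (CARD('p mod_ring) ^ CARD('m)) *s (R 0 *v x)"
      by (rule fourier_inversion)
    finally show ?thesis
      by (simp add: R_0)
  qed
  then have "R v = mat 1"
    by (simp add: matrix_eq)
  with assms show False ..
qed

text \<open>
  An operator that normalises the group, acting on it by \<open>L\<close>, carries eigenvectors to eigenvectors;
  the new character \<open>b\<close> is determined by its pullback along \<open>L\<close> being the old one.
\<close>

lemma spectrum_dual:
  assumes "a \<in> spectrum" and T: "invertible T" and TR: "\<And>v. T ** R v = R (L v) ** T"
    and "surj L" and dual: "\<And>v. dot b (L v) = dot a v"
  shows "b \<in> spectrum"
proof -
  obtain x where x: "x \<noteq> 0" "eigen a x"
    using assms(1) unfolding spectrum_def by blast
  have "eigen b (T *v x)"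
    unfolding eigen_def
  proof
    fix w
    obtain v where v: "w = L v" using \<open>surj L\<close> by blast
    have "R w *v (T *v x) = T *v (R v *v x)"
      by (simp add: matrix_vector_mul_assoc v TR)
    also have "\<dots> = add_char (dot a v) *s (T *v x)"
      using x(2) by (simp add: eigen_def vec.scale)
    finally show "R w *v (T *v x) = add_char (dot b w) *s (T *v x)"
      by (simp add: v dual)
  qed
  moreover have "T *v x \<noteq> 0"
  proof
    assume 0: "T *v x = 0"
    obtain T' where "T' ** T = mat 1" using T unfolding invertible_def by blast
    then have "x = T' *v (T *v x)" by (simp add: matrix_vector_mul_assoc)
    then show False using 0 x(1) by simp
  qed
  ultimately show ?thesis unfolding spectrum_def by blast
qed

end

section \<open>Counting vectors with free coordinates\<close>

lemma card_ge_of_free_coordinates: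
  fixes S :: "('a::finite ^ 'm) set"
  assumes "\<And>w f. w \<in> W \<Longrightarrow> \<exists>a\<in>S. a $ i0 = w \<and> (\<forall>j\<in>J. a $ j = f j)"
  shows "card W * CARD('a) ^ card J \<le> card S"
proof -
  have "W \<times> (J \<rightarrow>\<^sub>E (UNIV :: 'a set)) \<subseteq> (\<lambda>a. (a $ i0, restrict (\<lambda>j. a $ j) J)) ` S"
  proof (rule subsetI, clarify)
    fix w f assume w: "w \<in> W" and f: "f \<in> J \<rightarrow>\<^sub>E (UNIV :: 'a set)"
    obtain a where a: "a \<in> S" "a $ i0 = w" "\<forall>j\<in>J. a $ j = f j"
      using assms[OF w] by blast
    have "restrict (\<lambda>j. a $ j) J = f"
      using a(3) f by (auto simp: restrict_def PiE_def extensional_def)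
    then show "(w, f) \<in> (\<lambda>a. (a $ i0, restrict (\<lambda>j. a $ j) J)) ` S"
      using a by force
  qed
  then have "card (W \<times> (J \<rightarrow>\<^sub>E (UNIV :: 'a set))) \<le> card S"
    by (rule surj_card_le[rotated]) simp
  then show ?thesis
    by (simp add: card_cartesian_product card_PiE)
qed

text \<open>
  This is the counting step for spectra: shears allow the coordinates in \<open>J\<close> to be prescribed one
  after the other, because none of them changes the coordinate \<open>i0\<close> on which the shears depend.
\<close>

lemma card_ge_of_shears:
  fixes S :: "('a::{finite,comm_ring_1} ^ 'm) set"
  assumes shear: "\<And>a j c. a \<in> S \<Longrightarrow> a $ i0 \<noteq> 0 \<Longrightarrow> j \<in> J \<Longrightarrow> a + axis j c \<in> S"
    and "i0 \<notin> J" and W: "W \<subseteq> (\<lambda>a. a $ i0) ` S - {0}"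
  shows "card W * CARD('a) ^ card J \<le> card S"
proof (rule card_ge_of_free_coordinates)
  fix w f assume "w \<in> W"
  then obtain a where a: "a \<in> S" "a $ i0 = w" "w \<noteq> 0"
    using W by blast
  have "\<exists>b\<in>S. b $ i0 = w \<and> (\<forall>j\<in>A. b $ j = f j)" if "A \<subseteq> J" for A
    using finite[of A] that
  proof (induction A rule: finite_induct)
    case empty
    then show ?case using a by blast
  next
    case (insert j A)
    then obtain b where b: "b \<in> S" "b $ i0 = w" "\<forall>j\<in>A. b $ j = f j"
      by auto
    define b' where "b' = b + axis j (f j - b $ j)"
    have "b' \<in> S"
      unfolding b'_def using b insert.prems a(3) by (intro shear) auto
    moreover have "b' $ l = (if l = j then f j else b $ l)" for l
      by (simp add: b'_def axis_def)
    moreover have "i0 \<noteq> j"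
      using insert.prems \<open>i0 \<notin> J\<close> by blast
    ultimately show ?case
      using b by (intro bexI[of _ b']) auto
  qed
  then show "\<exists>b\<in>S. b $ i0 = w \<and> (\<forall>j\<in>J. b $ j = f j)"
    by blast
qed

text \<open>A square has at most the two square roots \<open>s\<close> and \<open>- s\<close>, so squaring is at most two-to-one.\<close>

lemma card_square_multiples:
  fixes c :: "'p::prime_card mod_ring"
  assumes "c \<noteq> 0"
  shows "CARD('p) - 1 \<le> 2 * card {t * t * c |t. t \<noteq> 0}"
proof -
  let ?W = "{t * t * c |t. t \<noteq> 0}"
  have "card (UNIV - {0 :: 'p mod_ring}) \<le> card (\<Union>w\<in>?W. {t. t * t * c = w})"
    by (rule card_mono) auto
  also have "\<dots> \<le> (\<Sum>w\<in>?W. card {t. t * t * c = w})"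
    by (rule card_UN_le) simp
  also have "\<dots> \<le> (\<Sum>w\<in>?W. 2)"
  proof (rule sum_mono)
    fix w assume "w \<in> ?W"
    then obtain s where s: "w = s * s * c" by blast
    have "{t. t * t * c = w} \<subseteq> {s, - s}"
      using assms by (auto simp: s square_eq_iff)
    then have "card {t. t * t * c = w} \<le> card {s, - s}"
      by (rule card_mono[rotated]) simp
    also have "\<dots> \<le> 2"
      by (simp add: card_insert_if)
    finally show "card {t. t * t * c = w} \<le> 2" .
  qed
  finally show ?thesis by (simp add: card_Diff_singleton)
qed

section \<open>Congruence levels in the \<open>p\<close>-adic integers\<close>

lemmas padic_residue_simps = zero_padic_int.rep_eq one_padic_int.rep_eq plus_padic_int.rep_eq
  minus_padic_int.rep_eq uminus_padic_int.rep_eq times_padic_int.rep_eq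

lemma padic_eqI:
  fixes x y :: "'p::prime_card padic_int"
  assumes "\<And>n. padic_residue x n = padic_residue y n"
  shows "x = y"
  using assms by (auto simp: padic_residue_inject[symmetric])

lemma padic_residue_mod_self [simp]:
  "padic_residue (x :: 'p::prime_card padic_int) n mod int CARD('p) ^ n = padic_residue x n"
  using padic_residue[of x] by (auto intro: mod_pos_pos_trivial)

lemma padic_residue_mod_le:
  fixes x :: "'p::prime_card padic_int"
  assumes "m \<le> n"
  shows "padic_residue x n mod int CARD('p) ^ m = padic_residue x m"
  using assms
proof (induction n rule: dec_induct)
  case base
  show ?case by simp
next
  case (step n)
  have "padic_residue x (Suc n) mod int CARD('p) ^ n = padic_residue x n"
    using padic_residue[of x] by blast
  moreover have "int CARD('p) ^ m dvd int CARD('p) ^ n"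
    using step.hyps by (simp add: le_imp_power_dvd)
  ultimately show ?case
    using step.IH by (metis mod_mod_cancel)
qed

lemma padic_residue_of_nat:
  "padic_residue (of_nat k :: 'p::prime_card padic_int) n = int k mod int CARD('p) ^ n"
  by (induction k) (simp_all add: padic_residue_simps mod_add_left_eq mod_add_right_eq)

lemma padic_residue_of_int:
  "padic_residue (of_int k :: 'p::prime_card padic_int) n = k mod int CARD('p) ^ n"
  by (cases k rule: int_cases2)
    (simp_all add: padic_residue_simps padic_residue_of_nat mod_minus_eq)

text \<open>The ideal generated by \<open>p ^ n\<close>.\<close>

definition pideal :: "nat \<Rightarrow> 'p::prime_card padic_int set" where
  "pideal n = {z. padic_residue z n = 0}"

lemma pideal_0 [simp]: "z \<in> pideal 0"
proof -
  have "padic_residue z 0 mod int CARD('a) ^ 0 = padic_residue z 0"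
    by (rule padic_residue_mod_self)
  then show ?thesis by (simp add: pideal_def)
qed

lemma zero_in_pideal [simp]: "0 \<in> pideal n"
  by (simp add: pideal_def padic_residue_simps)

lemma pideal_add: "x \<in> pideal n \<Longrightarrow> y \<in> pideal n \<Longrightarrow> x + y \<in> pideal n"
  by (simp add: pideal_def padic_residue_simps)

lemma pideal_diff: "x \<in> pideal n \<Longrightarrow> y \<in> pideal n \<Longrightarrow> x - y \<in> pideal n"
  by (simp add: pideal_def padic_residue_simps)

lemma pideal_uminus: "x \<in> pideal n \<Longrightarrow> - x \<in> pideal n"
  by (simp add: pideal_def padic_residue_simps)

lemma pideal_mult_left: "x \<in> pideal n \<Longrightarrow> y * x \<in> pideal n"
  by (simp add: pideal_def padic_residue_simps)

lemma pideal_mult_right: "x \<in> pideal n \<Longrightarrow> x * y \<in> pideal n"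
  by (simp add: pideal_def padic_residue_simps)

lemma pideal_antimono: "m \<le> n \<Longrightarrow> x \<in> pideal n \<Longrightarrow> x \<in> pideal m"
  using padic_residue_mod_le[of m n x] by (simp add: pideal_def)

lemma of_int_in_pideal_iff:
  "(of_int k :: 'p::prime_card padic_int) \<in> pideal n \<longleftrightarrow> int CARD('p) ^ n dvd k"
  by (auto simp: pideal_def padic_residue_of_int)

lemma diff_in_pideal_iff:
  fixes x y :: "'p::prime_card padic_int"
  shows "x - y \<in> pideal n \<longleftrightarrow> padic_residue x n = padic_residue y n"
proof -
  have "x - y \<in> pideal n \<longleftrightarrow> padic_residue x n mod int CARD('p) ^ n = padic_residue y n mod int CARD('p) ^ n"
    by (simp only: pideal_def mem_Collect_eq padic_residue_simps mod_eq_dvd_iff dvd_eq_mod_eq_0)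
  then show ?thesis by simp
qed

text \<open>
  The inverse is glued from inverses modulo the powers of \<open>p\<close>, which form a compatible sequence since
  inverses modulo \<open>p ^ n\<close> are unique. In particular the ring is local.
\<close>

lemma padic_unit_iff: "z dvd 1 \<longleftrightarrow> z \<notin> pideal (Suc 0)"
  for z :: "'p::prime_card padic_int"
proof
  assume "z dvd 1"
  then obtain w where w: "1 = z * w" by (rule dvdE)
  show "z \<notin> pideal (Suc 0)"
  proof
    assume "z \<in> pideal (Suc 0)"
    then have "z * w \<in> pideal (Suc 0)"
      by (rule pideal_mult_right)
    then have "1 \<in> (pideal (Suc 0) :: 'p padic_int set)"
      by (simp only: w)
    then show False
      using padic_pow_Suc_gt_1[where 'p = 'p, of 0] by (simp add: pideal_def padic_residue_simps)
  qed
next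
  assume z: "z \<notin> pideal (Suc 0)"
  let ?p = "int CARD('p)"
  have "\<exists>k. padic_residue z n * k mod ?p ^ n = 1 mod ?p ^ n" for n
  proof (cases "n = 0")
    case False
    have "padic_residue z n mod ?p \<noteq> 0"
      using z padic_residue_mod_le[of "Suc 0" n z] False by (simp add: pideal_def)
    then have "coprime ?p (padic_residue z n)"
      by (intro prime_imp_coprime prime_card_int) auto
    then have "coprime (padic_residue z n) (?p ^ n)"
      by (simp add: coprime_commute)
    then obtain k where "[padic_residue z n * k = 1] (mod ?p ^ n)"
      using cong_solve_coprime_int by blast
    then show ?thesis by (auto simp: cong_def)
  qed simp
  then obtain k where k: "\<And>n. padic_residue z n * k n mod ?p ^ n = 1 mod ?p ^ n"
    by metis
  have inv_unique: "a mod ?p ^ n = b mod ?p ^ n"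
    if "padic_residue z n * a mod ?p ^ n = 1 mod ?p ^ n"
      "padic_residue z n * b mod ?p ^ n = 1 mod ?p ^ n" for a b n
  proof -
    have "[padic_residue z n * a = 1] (mod ?p ^ n)" "[padic_residue z n * b = 1] (mod ?p ^ n)"
      using that by (simp_all add: cong_def)
    then have "[a = b] (mod ?p ^ n)"
      by (metis cong_mult_lcancel cong_sym cong_trans coprime_iff_invertible_int)
    then show ?thesis by (simp add: cong_def)
  qed
  have compat: "k (Suc n) mod ?p ^ n = k n mod ?p ^ n" for n
  proof (rule inv_unique[OF _ k])
    have "padic_residue z n * k (Suc n) mod ?p ^ n
        = (padic_residue z (Suc n) mod ?p ^ n) * k (Suc n) mod ?p ^ n"
      by (simp add: padic_residue_mod_le)
    also have "\<dots> = (padic_residue z (Suc n) * k (Suc n) mod ?p ^ Suc n) mod ?p ^ n"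
      by (simp only: mod_mult_left_eq mod_padic_pow_Suc)
    also have "\<dots> = 1 mod ?p ^ n"
      by (simp only: k mod_padic_pow_Suc)
    finally show "padic_residue z n * k (Suc n) mod ?p ^ n = 1 mod ?p ^ n" .
  qed
  have res: "padic_residue (Abs_padic_int (\<lambda>n. k n mod ?p ^ n) :: 'p padic_int) n = k n mod ?p ^ n" for n
    by (subst Abs_padic_int_inverse) (use compatible_modI[OF compat] in auto)
  have "1 = z * Abs_padic_int (\<lambda>n. k n mod ?p ^ n)"
    by (rule padic_eqI) (simp add: padic_residue_simps res mod_mult_right_eq k)
  then show "z dvd 1" by (rule dvdI)
qed

lemma nonunit_padic_add:
  fixes x y :: "'p::prime_card padic_int"
  shows "\<not> x dvd 1 \<Longrightarrow> \<not> y dvd 1 \<Longrightarrow> \<not> (x + y) dvd 1"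
  by (simp add: padic_unit_iff pideal_add)

text \<open>
  The quotient of \<open>pideal n\<close> by \<open>pideal (Suc n)\<close> is isomorphic to the field with \<open>p\<close> elements, and
  \<open>digit n\<close> chooses representatives. It is additive only modulo \<open>pideal (Suc n)\<close>. For \<open>n = 0\<close> it lifts the residue field, so \<open>digit 0\<close> of a
  non-zero element is a unit.
\<close>

definition digit :: "nat \<Rightarrow> 'p::prime_card mod_ring \<Rightarrow> 'p padic_int" where
  "digit n x = of_int (int CARD('p) ^ n * to_int_mod_ring x)"

lemma pow_dvd_pow_Suc_mult:
  "q dvd k \<Longrightarrow> q ^ Suc n dvd q ^ n * (k::int)"
  by (auto simp: dvd_def)

lemma digit_add: "digit n (x + y) - (digit n x + digit n y) \<in> pideal (Suc n)"
proof -
  have "int CARD('a) dvd to_int_mod_ring (x + y) - (to_int_mod_ring x + to_int_mod_ring y)"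
    by (simp add: to_int_mod_ring_add mod_eq_dvd_iff[symmetric])
  from pow_dvd_pow_Suc_mult[OF this, of n]
  have "(of_int (int CARD('a) ^ n * (to_int_mod_ring (x + y) - (to_int_mod_ring x + to_int_mod_ring y)))
      :: 'a padic_int) \<in> pideal (Suc n)"
    by (simp only: of_int_in_pideal_iff)
  then show ?thesis by (simp add: digit_def algebra_simps)
qed

lemma digit_mult: "digit n (x * y) - digit 0 x * digit n y \<in> pideal (Suc n)"
proof -
  have "int CARD('a) dvd to_int_mod_ring (x * y) - to_int_mod_ring x * to_int_mod_ring y"
    by (simp add: to_int_mod_ring_mult mod_eq_dvd_iff[symmetric])
  from pow_dvd_pow_Suc_mult[OF this, of n]
  have "(of_int (int CARD('a) ^ n * (to_int_mod_ring (x * y) - to_int_mod_ring x * to_int_mod_ring y))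
      :: 'a padic_int) \<in> pideal (Suc n)"
    by (simp only: of_int_in_pideal_iff)
  then show ?thesis by (simp add: digit_def algebra_simps)
qed

text \<open>
  Multiplication by \<open>c\<close> acts on the quotient \<open>pideal n / pideal (Suc n)\<close> as multiplication by \<open>s\<close>
  does on the residue field. Only this effect matters when a matrix with entry \<open>c\<close> acts on a layer.
\<close>

definition reduces_to :: "nat \<Rightarrow> 'p::prime_card padic_int \<Rightarrow> 'p mod_ring \<Rightarrow> bool" where
  "reduces_to n c s \<longleftrightarrow> (\<forall>x. c * digit n x - digit n (s * x) \<in> pideal (Suc n))"

lemma reduces_to_digit: "reduces_to n (digit 0 s) s"
  unfolding reduces_to_def using digit_mult pideal_uminus by (metis minus_diff_eq)

lemma reduces_to_1: "reduces_to n 1 1"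
  by (simp add: reduces_to_def)

lemma reduces_to_add:
  assumes "reduces_to n c s" "reduces_to n d t"
  shows "reduces_to n (c + d) (s + t)"
  unfolding reduces_to_def
proof
  fix x
  have "(c + d) * digit n x - digit n ((s + t) * x) = (c * digit n x - digit n (s * x))
      + (d * digit n x - digit n (t * x)) - (digit n (s * x + t * x) - (digit n (s * x) + digit n (t * x)))"
    by (simp add: algebra_simps)
  then show "(c + d) * digit n x - digit n ((s + t) * x) \<in> pideal (Suc n)"
    using assms unfolding reduces_to_def by (metis pideal_add pideal_diff digit_add)
qed

lemma reduces_to_mult:
  assumes "reduces_to n c s" "reduces_to n d t"
  shows "reduces_to n (c * d) (s * t)"
  unfolding reduces_to_def
proof
  fix x
  have "c * d * digit n x - digit n (s * t * x)
      = c * (d * digit n x - digit n (t * x)) + (c * digit n (t * x) - digit n (s * (t * x)))"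
    by (simp add: algebra_simps)
  then show "c * d * digit n x - digit n (s * t * x) \<in> pideal (Suc n)"
    using assms unfolding reduces_to_def by (metis pideal_add pideal_mult_left)
qed

lemma digit_zero [simp]: "digit n 0 = 0"
  by (simp add: digit_def)

lemma digit_unit: "x \<noteq> 0 \<Longrightarrow> digit 0 x dvd 1"
proof -
  assume "x \<noteq> 0"
  moreover have "to_int_mod_ring x \<in> {0..<int CARD('a)}"
    using range_to_int_mod_ring[where 'a = 'a] by blast
  ultimately have "\<not> int CARD('a) dvd to_int_mod_ring x"
    by (auto dest!: zdvd_imp_le) (metis of_int_mod_ring_to_int_mod_ring to_int_mod_ring_of_int_mod_ring
      less_le of_int_mod_ring.abs_eq zero_mod_ring.abs_eq mod_0)
  then show ?thesis
    unfolding digit_def by (simp add: padic_unit_iff of_int_in_pideal_iff del: of_int_mult of_int_power)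
qed

lemma ex_digit:
  fixes z :: "'p::prime_card padic_int"
  assumes "z \<in> pideal n"
  shows "\<exists>x. z - digit n x \<in> pideal (Suc n)"
proof -
  let ?p = "int CARD('p)"
  let ?r = "padic_residue z (Suc n) div ?p ^ n"
  have "padic_residue z (Suc n) mod ?p ^ n = 0"
    using assms padic_residue_mod_le[of n "Suc n" z] by (simp add: pideal_def)
  then have eq: "?p ^ n * ?r = padic_residue z (Suc n)"
    by (simp add: mod_0_imp_dvd)
  have range: "padic_residue z (Suc n) \<in> {0..<?p ^ Suc n}"
    using padic_residue[of z] by blast
  have "0 \<le> ?r" "?r < ?p"
    using range padic_pow_pos[where 'p = 'p and n = n]
    using eq mult_left_mono[of ?p ?r "?p ^ n"]
    by (auto simp: pos_imp_zdiv_nonneg_iff not_less mult.commute intro: leI)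
  then have "to_int_mod_ring (of_int_mod_ring ?r :: 'p mod_ring) = ?r"
    by (rule to_int_mod_ring_of_int_mod_ring)
  then have "digit n (of_int_mod_ring ?r :: 'p mod_ring) = of_int (padic_residue z (Suc n))"
    by (simp only: digit_def eq)
  then have "z - digit n (of_int_mod_ring ?r) \<in> pideal (Suc n)"
    by (simp add: diff_in_pideal_iff padic_residue_of_int del: power_Suc)
  then show ?thesis by blast
qed

section \<open>Continuity and the absence of small subgroups\<close>

text \<open>
  The sum of the absolute values of the entries; it is submultiplicative, which is all that the
  argument below needs of a matrix norm.
\<close>

definition mnorm :: "complex ^ 'd ^ 'd \<Rightarrow> real" where
  "mnorm A = (\<Sum>i\<in>UNIV. \<Sum>j\<in>UNIV. norm (A $ i $ j))"

lemma mnorm_triangle: "mnorm (A - B) \<le> mnorm A + mnorm B"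
  by (simp add: mnorm_def sum.distrib[symmetric] sum_mono norm_triangle_ineq4)

lemma mnorm_double: "mnorm (A + A) = 2 * mnorm A"
  by (simp add: mnorm_def sum_distrib_left norm_mult flip: mult_2)

lemma mnorm_mult: "mnorm (A ** B) \<le> mnorm A * mnorm B"
proof -
  have "norm ((A ** B) $ i $ j) \<le> (\<Sum>k\<in>UNIV. norm (A $ i $ k) * norm (B $ k $ j))" for i j
    by (simp add: matrix_matrix_mult_def sum_norm_le norm_mult)
  then have "mnorm (A ** B) \<le> (\<Sum>i\<in>UNIV. \<Sum>j\<in>UNIV. \<Sum>k\<in>UNIV. norm (A $ i $ k) * norm (B $ k $ j))"
    unfolding mnorm_def by (intro sum_mono)
  also have "\<dots> = (\<Sum>i\<in>UNIV. \<Sum>k\<in>UNIV. norm (A $ i $ k) * (\<Sum>j\<in>UNIV. norm (B $ k $ j)))"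
    by (subst sum.swap) (simp add: sum_distrib_left)
  also have "\<dots> \<le> (\<Sum>i\<in>UNIV. \<Sum>k\<in>UNIV. norm (A $ i $ k) * mnorm B)"
    by (intro sum_mono mult_left_mono norm_ge_zero)
      (unfold mnorm_def, rule member_le_sum[of _ UNIV "\<lambda>k. \<Sum>j\<in>UNIV. norm (B $ k $ j)"],
        auto intro: sum_nonneg)
  also have "\<dots> = mnorm A * mnorm B"
    by (simp add: mnorm_def sum_distrib_right)
  finally show ?thesis .
qed

lemma mnorm_nonneg: "0 \<le> mnorm A"
  by (simp add: mnorm_def sum_nonneg)

lemma mnorm_eq_0_iff: "mnorm A = 0 \<longleftrightarrow> A = 0"
  by (simp add: mnorm_def sum_nonneg sum_nonneg_eq_0_iff vec_eq_iff)

lemma matrix_add_left_distrib: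
  fixes A B :: "'a::semiring_1 ^ 'n ^ 'm" and C :: "'a ^ 'k ^ 'n"
  shows "(A + B) ** C = A ** C + B ** C"
  by (simp add: vec_eq_iff matrix_matrix_mult_def distrib_right sum.distrib)

text \<open>
  With \<open>E = M - 1\<close> the identity \<open>2 E = (M\<^sup>2 - 1) - E\<^sup>2\<close> shows that a bound \<open>\<delta> \<le> 1 / 2\<close> valid
  for all \<open>M\<close> in the set improves to \<open>(\<delta> + \<delta> / 2) / 2\<close>, that is, to \<open>3 / 4\<close> of itself. Iteration
  forces \<open>E = 0\<close>.
\<close>

lemma no_small_subgroup:
  assumes "\<And>M. M \<in> \<Gamma> \<Longrightarrow> M ** M \<in> \<Gamma>" "\<And>M. M \<in> \<Gamma> \<Longrightarrow> mnorm (M - mat 1) \<le> 1 / 2" "M \<in> \<Gamma>"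
  shows "M = mat 1"
proof -
  have bound: "mnorm (M - mat 1) \<le> (3 / 4) ^ n * (1 / 2)" if "M \<in> \<Gamma>" for n M
    using that
  proof (induction n arbitrary: M)
    case 0
    then show ?case using assms(2) by simp
  next
    case (Suc n)
    let ?E = "M - mat 1"
    have "?E + ?E = (M ** M - mat 1) - ?E ** ?E"
    proof -
      have "M ** M = (?E + mat 1) ** (?E + mat 1)"
        by simp
      also have "\<dots> = ?E ** ?E + ?E + ?E + mat 1"
        by (simp only: matrix_add_ldistrib matrix_add_left_distrib matrix_mul_lid matrix_mul_rid add.assoc)
      finally show ?thesis by simp
    qed
    then have "2 * mnorm ?E \<le> mnorm (M ** M - mat 1) + mnorm (?E ** ?E)"
      by (metis mnorm_double mnorm_triangle)
    also have "\<dots> \<le> (3 / 4) ^ n * (1 / 2) + mnorm ?E * mnorm ?E"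
      by (intro add_mono Suc.IH assms(1) Suc.prems mnorm_mult)
    also have "mnorm ?E * mnorm ?E \<le> mnorm ?E * (1 / 2)"
      by (intro mult_left_mono assms(2) Suc.prems mnorm_nonneg)
    also have "mnorm ?E * (1 / 2) \<le> ((3 / 4) ^ n * (1 / 2)) * (1 / 2)"
      by (intro mult_right_mono Suc.IH Suc.prems) simp
    finally show ?case by simp
  qed
  have "(\<lambda>n. (3 / 4 :: real) ^ n * (1 / 2)) \<longlonglongrightarrow> 0 * (1 / 2)"
    by (intro tendsto_mult tendsto_const LIMSEQ_power_zero) simp
  from LIMSEQ_le_const[OF this] have "mnorm (M - mat 1) \<le> 0 * (1 / 2)"
    using bound[OF assms(3)] by blast
  then show ?thesis
    using mnorm_nonneg[of "M - mat 1"] mnorm_eq_0_iff[of "M - mat 1"] by simp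
qed

lemma padic_vec_nbhd:
  fixes x :: "'p::prime_card padic_int ^ 'n"
  assumes "open V" "x \<in> V"
  shows "\<exists>N. \<forall>y. (\<forall>i. y $ i - x $ i \<in> pideal N) \<longrightarrow> y \<in> V"
proof -
  obtain T where T: "\<And>i. open (T i)" "\<And>i. x $ i \<in> T i" "\<And>y. (\<forall>i. y $ i \<in> T i) \<Longrightarrow> y \<in> V"
    using assms unfolding open_vec_def by metis
  have "\<exists>n. {y. padic_residue y n = padic_residue (x $ i) n} \<subseteq> T i" for i
    using T(1,2)[of i] unfolding open_padic_int_def by blast
  then obtain n where n: "\<And>i. {y. padic_residue y (n i) = padic_residue (x $ i) (n i)} \<subseteq> T i"
    by metis
  define N where "N = Max (range n)"
  have "y \<in> V" if "\<forall>i. y $ i - x $ i \<in> pideal N" for y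
  proof (rule T(3), rule allI)
    fix i
    have "n i \<le> N" by (simp add: N_def)
    then have "y $ i - x $ i \<in> pideal (n i)"
      using that pideal_antimono by blast
    then show "y $ i \<in> T i"
      using n[of i] by (auto simp: diff_in_pideal_iff)
  qed
  then show ?thesis by blast
qed

lemma padic_matrix_nbhd:
  fixes A :: "'p::prime_card padic_int ^ 'n ^ 'm"
  assumes "open V" "A \<in> V"
  shows "\<exists>N. \<forall>B. (\<forall>i j. B $ i $ j - A $ i $ j \<in> pideal N) \<longrightarrow> B \<in> V"
proof -
  obtain T where T: "\<And>i. open (T i)" "\<And>i. A $ i \<in> T i" "\<And>y. (\<forall>i. y $ i \<in> T i) \<Longrightarrow> y \<in> V"
    using assms unfolding open_vec_def[of V] by metis
  obtain n where n: "\<And>i y. (\<forall>j. y $ j - A $ i $ j \<in> pideal (n i)) \<Longrightarrow> y \<in> T i"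
    using padic_vec_nbhd[OF T(1,2)] by metis
  define N where "N = Max (range n)"
  have "B \<in> V" if "\<forall>i j. B $ i $ j - A $ i $ j \<in> pideal N" for B
  proof (rule T(3), intro allI n)
    fix i j
    have "n i \<le> N" by (simp add: N_def)
    then show "B $ i $ j - A $ i $ j \<in> pideal (n i)"
      using that pideal_antimono by blast
  qed
  then show ?thesis by blast
qed

lemma continuous_on_mnorm_diff: "continuous_on UNIV (\<lambda>B. mnorm (B - C))"
  unfolding mnorm_def by (intro continuous_intros)

lemma continuous_representation_near_one:
  fixes \<rho> :: "'p::prime_card padic_int ^ 'n ^ 'n \<Rightarrow> complex ^ 'd ^ 'd"
  assumes "continuous_representation G \<rho>" "mat 1 \<in> carrier G" "\<rho> (mat 1) = mat 1"
  shows "\<exists>N. \<forall>A\<in>carrier G. (\<forall>i j. A $ i $ j - mat 1 $ i $ j \<in> pideal N) \<longrightarrow> mnorm (\<rho> A - mat 1) \<le> 1 / 2"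
proof -
  have "open {B :: complex ^ 'd ^ 'd. mnorm (B - mat 1) < 1 / 2}"
    by (intro open_Collect_less continuous_on_mnorm_diff continuous_on_const)
  moreover have "continuous_on (carrier G) \<rho>"
    using assms(1) by (simp add: continuous_representation_def)
  ultimately obtain V where V: "open V" "V \<inter> carrier G = \<rho> -` {B. mnorm (B - mat 1) < 1 / 2} \<inter> carrier G"
    unfolding continuous_on_open_invariant by metis
  have "mnorm (\<rho> (mat 1) - mat 1) < 1 / 2"
    by (simp add: assms(3) mnorm_def)
  with assms(2) V(2) have "mat 1 \<in> V" by blast
  from padic_matrix_nbhd[OF V(1) this]
  obtain N where "\<And>B. (\<forall>i j. B $ i $ j - mat 1 $ i $ j \<in> pideal N) \<Longrightarrow> B \<in> V"
    by blast
  with V(2) have "\<forall>A\<in>carrier G. (\<forall>i j. A $ i $ j - mat 1 $ i $ j \<in> pideal N) \<longrightarrow> mnorm (\<rho> A - mat 1) < 1 / 2"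
    by blast
  then show ?thesis by (meson less_imp_le)
qed

section \<open>The first non-trivial layer of a homomorphism\<close>

definition lift_digit :: "nat \<Rightarrow> 'p::prime_card mod_ring ^ 'm \<Rightarrow> 'p padic_int ^ 'm" where
  "lift_digit n v = (\<chi> i. digit n (v $ i))"

lemma lift_digit_axis: "lift_digit n (axis i x) = axis i (digit n x)"
  by (auto simp: lift_digit_def axis_def vec_eq_iff)

text \<open>
  A parametrised abelian subgroup of a matrix group, composed with a representation, is a
  homomorphism of this kind.
\<close>

locale padic_hom =
  fixes \<Phi> :: "'p::prime_card padic_int ^ 'm \<Rightarrow> complex ^ 'd ^ 'd"
  assumes \<Phi>_0: "\<Phi> 0 = mat 1"
    and \<Phi>_add: "\<Phi> (u + v) = \<Phi> u ** \<Phi> v"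
begin

lemma \<Phi>_cong:
  assumes "\<And>u. (\<forall>i. u $ i \<in> pideal n) \<Longrightarrow> \<Phi> u = mat 1"
    and "\<And>i. u $ i - v $ i \<in> pideal n"
  shows "\<Phi> u = \<Phi> v"
proof -
  have "\<Phi> (u - v) = mat 1"
    by (rule assms(1)) (simp add: assms(2))
  then show ?thesis
    using \<Phi>_add[of "u - v" v] by simp
qed

lemma level_spectrum_dual:
  assumes triv: "\<And>u. (\<forall>i. u $ i \<in> pideal (Suc n)) \<Longrightarrow> \<Phi> u = mat 1"
    and rep: "elementary_rep (\<lambda>v. \<Phi> (lift_digit n v))"
    and a: "a \<in> elementary_rep.spectrum (\<lambda>v. \<Phi> (lift_digit n v))"
    and T: "invertible T" "\<And>u. T ** \<Phi> u = \<Phi> (\<Lambda> u) ** T"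
    and \<Lambda>: "\<And>v i. \<Lambda> (lift_digit n v) $ i - digit n (L v $ i) \<in> pideal (Suc n)"
    and L: "surj L" "\<And>v. dot b (L v) = dot a v"
  shows "b \<in> elementary_rep.spectrum (\<lambda>v. \<Phi> (lift_digit n v))"
proof (rule elementary_rep.spectrum_dual[OF rep a T(1) _ L])
  fix v
  have "\<Phi> (\<Lambda> (lift_digit n v)) = \<Phi> (lift_digit n (L v))"
    by (rule \<Phi>_cong[OF triv]) (auto simp: lift_digit_def intro: \<Lambda>[unfolded lift_digit_def])
  then show "T ** \<Phi> (lift_digit n v) = \<Phi> (lift_digit n (L v)) ** T"
    by (simp add: T(2))
qed

text \<open>
  The dual of the shear that adds a multiple of coordinate \<open>j\<close> to coordinate \<open>i\<close> changes coordinate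
  \<open>j\<close> by a multiple of coordinate \<open>i\<close>.
\<close>

lemma level_spectrum_shear:
  assumes triv: "\<And>u. (\<forall>i. u $ i \<in> pideal (Suc n)) \<Longrightarrow> \<Phi> u = mat 1"
    and rep: "elementary_rep (\<lambda>v. \<Phi> (lift_digit n v))"
    and a: "a \<in> elementary_rep.spectrum (\<lambda>v. \<Phi> (lift_digit n v))"
    and "i \<noteq> j" and c: "reduces_to n c s"
    and T: "invertible T" "\<And>u. T ** \<Phi> u = \<Phi> (u + axis i (c * u $ j)) ** T"
  shows "a - axis j (s * a $ i) \<in> elementary_rep.spectrum (\<lambda>v. \<Phi> (lift_digit n v))"
proof (rule level_spectrum_dual[OF triv rep a T])
  let ?L = "\<lambda>v. v + axis i (s * v $ j)"
  fix v
  show "(lift_digit n v + axis i (c * lift_digit n v $ j)) $ l - digit n (?L v $ l) \<in> pideal (Suc n)" for l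
  proof (cases "l = i")
    case True
    have "digit n (v $ i) + c * digit n (v $ j) - digit n (v $ i + s * v $ j)
        = (c * digit n (v $ j) - digit n (s * v $ j))
          - (digit n (v $ i + s * v $ j) - (digit n (v $ i) + digit n (s * v $ j)))"
      by (simp add: algebra_simps)
    also have "\<dots> \<in> pideal (Suc n)"
      by (rule pideal_diff[OF c[unfolded reduces_to_def, rule_format] digit_add])
    finally show ?thesis
      using True by (simp add: lift_digit_def axis_def)
  qed (simp add: lift_digit_def axis_def)
  show "dot (a - axis j (s * a $ i)) (?L v) = dot a v"
    using \<open>i \<noteq> j\<close>
    by (simp add: dot_diff_left dot_add_right dot_axis dot_commute[of "axis j _"] algebra_simps)
      (simp add: axis_def)
  show "surj ?L"
  proof (rule surjI)
    show "?L (w - axis i (s * w $ j)) = w" for w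
      using \<open>i \<noteq> j\<close> by (simp add: vec_eq_iff axis_def)
  qed
qed

lemma level_spectrum_scale:
  assumes triv: "\<And>u. (\<forall>i. u $ i \<in> pideal (Suc n)) \<Longrightarrow> \<Phi> u = mat 1"
    and rep: "elementary_rep (\<lambda>v. \<Phi> (lift_digit n v))"
    and a: "a \<in> elementary_rep.spectrum (\<lambda>v. \<Phi> (lift_digit n v))"
    and s: "\<And>i. s i \<noteq> 0" "\<And>i. reduces_to n (c i) (s i)"
    and T: "invertible T" "\<And>u. T ** \<Phi> u = \<Phi> (\<chi> i. c i * u $ i) ** T"
  shows "(\<chi> i. a $ i / s i) \<in> elementary_rep.spectrum (\<lambda>v. \<Phi> (lift_digit n v))"
proof (rule level_spectrum_dual[OF triv rep a T])
  let ?L = "\<lambda>v. \<chi> i. s i * v $ i"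
  fix v
  show "(\<chi> i. c i * lift_digit n v $ i) $ l - digit n (?L v $ l) \<in> pideal (Suc n)" for l
    using s(2)[of l] by (simp add: lift_digit_def reduces_to_def)
  show "dot (\<chi> i. a $ i / s i) (?L v) = dot a v"
    using s(1) by (simp add: dot_def)
  show "surj ?L"
  proof (rule surjI)
    show "?L (\<chi> i. w $ i / s i) = w" for w
      using s(1) by (simp add: vec_eq_iff)
  qed
qed

text \<open>
  Let \<open>n + 1\<close> be the least exponent such that the homomorphism is trivial on vectors with entries in
  \<open>pideal (n + 1)\<close>; it exists because the image of a small neighbourhood of \<open>0\<close> is a subgroup close to
  the identity. On the representatives of \<open>pideal n\<close> modulo \<open>pideal (n + 1)\<close> the homomorphism is
  additive, since their own additivity fails only by elements on which it is trivial.
\<close>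

lemma exact_level:
  assumes small: "\<exists>N. \<forall>u. (\<forall>i. u $ i \<in> pideal N) \<longrightarrow> mnorm (\<Phi> u - mat 1) \<le> 1 / 2"
    and nontriv: "\<Phi> u0 \<noteq> mat 1"
  shows "\<exists>n. (\<forall>u. (\<forall>i. u $ i \<in> pideal (Suc n)) \<longrightarrow> \<Phi> u = mat 1)
    \<and> (\<exists>u. (\<forall>i. u $ i \<in> pideal n) \<and> \<Phi> u \<noteq> mat 1)
    \<and> elementary_rep (\<lambda>v. \<Phi> (lift_digit n v)) \<and> (\<exists>v. \<Phi> (lift_digit n v) \<noteq> mat 1)"
proof -
  define triv where "triv n \<longleftrightarrow> (\<forall>u. (\<forall>i. u $ i \<in> pideal n) \<longrightarrow> \<Phi> u = mat 1)" for n
  obtain N where N: "\<And>u. (\<forall>i. u $ i \<in> pideal N) \<Longrightarrow> mnorm (\<Phi> u - mat 1) \<le> 1 / 2"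
    using small by blast
  have "triv N"
    unfolding triv_def
  proof (intro allI impI)
    fix u :: "'p padic_int ^ 'm" assume u: "\<forall>i. u $ i \<in> pideal N"
    show "\<Phi> u = mat 1"
    proof (rule no_small_subgroup)
      let ?\<Gamma> = "\<Phi> ` {u. \<forall>i. u $ i \<in> pideal N}"
      show "M ** M \<in> ?\<Gamma>" if M: "M \<in> ?\<Gamma>" for M
      proof -
        obtain w where w: "M = \<Phi> w" "\<forall>i. w $ i \<in> pideal N" using M by blast
        have "M ** M = \<Phi> (w + w)" by (simp only: \<Phi>_add w(1))
        then show ?thesis using w(2) pideal_add by fastforce
      qed
      show "mnorm (M - mat 1) \<le> 1 / 2" if "M \<in> ?\<Gamma>" for M
        using that N by blast
      show "\<Phi> u \<in> ?\<Gamma>" using u by blast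
    qed
  qed
  moreover have "\<not> triv 0"
    using nontriv by (auto simp: triv_def)
  ultimately obtain n where n: "\<not> triv n" "triv (Suc n)"
    using ex_least_nat_less[of triv N] by blast
  have cong: "\<Phi> u = \<Phi> v" if "\<And>i. u $ i - v $ i \<in> pideal (Suc n)" for u v
    using \<Phi>_cong[of "Suc n"] n(2) that unfolding triv_def by blast
  obtain u where u: "\<forall>i. u $ i \<in> pideal n" "\<Phi> u \<noteq> mat 1"
    using n(1) unfolding triv_def by blast
  have "elementary_rep (\<lambda>v. \<Phi> (lift_digit n v))"
  proof
    have "lift_digit n 0 = (0 :: 'p padic_int ^ 'm)"
      by (simp add: lift_digit_def vec_eq_iff)
    then show "\<Phi> (lift_digit n 0) = mat 1"
      by (simp add: \<Phi>_0)
    show "\<Phi> (lift_digit n (v + w)) = \<Phi> (lift_digit n v) ** \<Phi> (lift_digit n w)" for v w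
      unfolding \<Phi>_add[symmetric] by (rule cong) (simp add: lift_digit_def digit_add)
  qed
  moreover have "\<exists>v. \<Phi> (lift_digit n v) \<noteq> mat 1"
  proof -
    obtain f where f: "\<And>i. u $ i - digit n (f i) \<in> pideal (Suc n)"
      using ex_digit[OF u(1)[rule_format]] by metis
    have "\<Phi> u = \<Phi> (lift_digit n (\<chi> i. f i))"
      by (rule cong) (simp add: lift_digit_def f)
    then show ?thesis using u(2) by metis
  qed
  ultimately show ?thesis
    using n u unfolding triv_def by blast
qed

end

section \<open>Elementary generation of the special linear group\<close>

text \<open>
  The entry of \<open>u\<close> at \<open>k\<close> itself is ignored, so that the diagonal stays equal to \<open>1\<close> while \<open>u\<close> ranges
  over all vectors of the full index type. The elementary matrix with entry \<open>c\<close> at row \<open>i\<close> and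
  column \<open>k\<close> is \<open>colmat k (axis i c)\<close>.
\<close>

definition colmat :: "'n \<Rightarrow> 'a::comm_ring_1 ^ 'n \<Rightarrow> 'a ^ 'n ^ 'n" where
  "colmat k u = (\<chi> a b. (if a = b then 1 else 0) + (if b = k \<and> a \<noteq> k then u $ a else 0))"

lemma colmat_mult_nth:
  "(colmat k u ** A) $ a $ b = A $ a $ b + (if a \<noteq> k then u $ a * A $ k $ b else 0)"
proof -
  have "(colmat k u ** A) $ a $ b
      = (\<Sum>l\<in>UNIV. (if l = a then A $ a $ b else 0) + (if l = k then (if a \<noteq> k then u $ a * A $ k $ b else 0) else 0))"
    unfolding matrix_matrix_mult_def colmat_def vec_lambda_beta
    by (rule sum.cong) (auto simp: algebra_simps)
  then show ?thesis by (simp add: sum.distrib)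
qed

lemma mult_colmat_axis_nth:
  assumes "i \<noteq> k"
  shows "(A ** colmat k (axis i c)) $ a $ b = A $ a $ b + (if b = k then A $ a $ i * c else 0)"
proof -
  have "(A ** colmat k (axis i c)) $ a $ b
      = (\<Sum>l\<in>UNIV. (if l = b then A $ a $ b else 0) + (if l = i then (if b = k then A $ a $ i * c else 0) else 0))"
    unfolding matrix_matrix_mult_def colmat_def vec_lambda_beta using assms
    by (intro sum.cong) (auto simp: algebra_simps axis_def)
  then show ?thesis by (simp add: sum.distrib)
qed

lemma colmat_add: "colmat k (u + v) = colmat k u ** colmat k v"
  by (auto simp: vec_eq_iff colmat_mult_nth) (auto simp: colmat_def)

lemma colmat_0: "colmat k 0 = mat 1"
  by (simp add: vec_eq_iff colmat_def mat_def)

lemma colmat_axis_self: "colmat k (axis k c) = mat 1"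
  by (auto simp: vec_eq_iff colmat_def mat_def axis_def)

lemma vec_eq_sum_axis: "u = (\<Sum>i\<in>UNIV. axis i (u $ i))"
  for u :: "'a::comm_monoid_add ^ 'm"
proof (rule vec_eq_iff[THEN iffD2, rule_format])
  fix l
  have "(\<Sum>i\<in>UNIV. axis i (u $ i) $ l) = (\<Sum>i\<in>UNIV. if i = l then u $ l else 0)"
    by (rule sum.cong) (auto simp: axis_def)
  then show "u $ l = (\<Sum>i\<in>UNIV. axis i (u $ i)) $ l" by simp
qed

lemma vec_axis_induct:
  fixes u :: "'a::comm_monoid_add ^ 'm"
  assumes "P 0" "\<And>i c. P (axis i c)" "\<And>u v. P u \<Longrightarrow> P v \<Longrightarrow> P (u + v)"
  shows "P u"
proof -
  have "P (\<Sum>i\<in>A. axis i (u $ i))" for A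
    by (induction A rule: infinite_finite_induct) (simp_all add: assms)
  from this[of UNIV] show ?thesis by (simp flip: vec_eq_sum_axis)
qed

lemma det_colmat: "det (colmat k u) = 1"
proof (induction u rule: vec_axis_induct)
  case (2 i c)
  show ?case
  proof (cases "i = k")
    case False
    have "colmat k (axis i c) = (\<chi> l. if l = i then row i (mat 1) + c *s row k (mat 1) else row l (mat 1))"
      using False by (auto simp: vec_eq_iff colmat_def row_def mat_def axis_def)
    then show ?thesis
      using det_row_operation[OF False, of "mat 1" c] by simp
  qed (simp add: colmat_axis_self)
qed (simp_all add: colmat_0 colmat_add det_mul)

definition rowmat :: "'n \<Rightarrow> 'a::comm_ring_1 ^ 'n \<Rightarrow> 'a ^ 'n ^ 'n" where
  "rowmat k u = transpose (colmat k u)"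

lemma mult_rowmat_nth:
  "(A ** rowmat k u) $ a $ b = A $ a $ b + (if b \<noteq> k then A $ a $ k * u $ b else 0)"
proof -
  have "A ** rowmat k u = transpose (colmat k u ** transpose A)"
    by (simp add: rowmat_def matrix_transpose_mul)
  then show ?thesis
    by (simp add: transpose_def colmat_mult_nth mult.commute)
qed

lemma rowmat_axis: "i \<noteq> k \<Longrightarrow> rowmat k (axis i c) = colmat i (axis k c)"
  by (auto simp: vec_eq_iff rowmat_def transpose_def colmat_def axis_def)

lemma rowmat_add: "rowmat k (u + v) = rowmat k u ** rowmat k v"
  unfolding rowmat_def matrix_transpose_mul[symmetric] colmat_add[symmetric] by (simp add: add.commute)

lemma nonunit_sum:
  fixes f :: "'b \<Rightarrow> 'a::comm_ring_1"
  assumes "\<And>x y :: 'a. \<not> x dvd 1 \<Longrightarrow> \<not> y dvd 1 \<Longrightarrow> \<not> x + y dvd 1"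
    and "\<And>i. i \<in> A \<Longrightarrow> \<not> f i dvd 1"
  shows "\<not> sum f A dvd 1"
  using assms(2)
  by (induction A rule: infinite_finite_induct) (simp_all add: assms(1))

text \<open>
  Every term of the Leibniz expansion contains an entry of column \<open>i\<close>. If those were all non-units,
  the determinant would be a sum of non-units and hence a non-unit.
\<close>

lemma unit_entry_in_column:
  fixes g :: "'a::comm_ring_1 ^ 'n ^ 'n"
  assumes local: "\<And>x y :: 'a. \<not> x dvd 1 \<Longrightarrow> \<not> y dvd 1 \<Longrightarrow> \<not> x + y dvd 1"
    and "det g = 1"
  shows "\<exists>l. g $ l $ i dvd 1"
proof (rule ccontr)
  assume *: "\<not> ?thesis"
  have "\<not> (\<Sum>\<pi> | \<pi> permutes UNIV. of_int (sign \<pi>) * (\<Prod>l\<in>UNIV. g $ l $ \<pi> l)) dvd 1"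
  proof (rule nonunit_sum[OF local])
    fix \<pi> :: "'n \<Rightarrow> 'n" assume "\<pi> \<in> {\<pi>. \<pi> permutes UNIV}"
    then obtain m where m: "\<pi> m = i"
      using permutes_surj[of \<pi> UNIV] by (metis mem_Collect_eq surjD)
    have "g $ m $ i dvd (\<Prod>l\<in>UNIV. g $ l $ \<pi> l)"
      using dvd_prodI[of UNIV m "\<lambda>l. g $ l $ \<pi> l"] by (simp add: m)
    then have "g $ m $ i dvd of_int (sign \<pi>) * (\<Prod>l\<in>UNIV. g $ l $ \<pi> l)"
      by (rule dvd_mult)
    then show "\<not> of_int (sign \<pi>) * (\<Prod>l\<in>UNIV. g $ l $ \<pi> l) dvd 1"
      using * dvd_trans by blast
  qed
  then show False using assms(2) by (simp add: det_def)
qed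

text \<open>
  Gaussian elimination over a local ring. \<open>C\<close> is the set of indices whose rows and columns do not
  yet agree with the identity matrix; each round removes one index \<open>i\<close> from it. The elimination needs a
  unit in column \<open>i\<close> off the diagonal, with which the diagonal entry is made \<open>1\<close>; after that column
  \<open>i\<close> and row \<open>i\<close> can be cleared. When at most one index is left, the matrix is diagonal with at
  most one entry different from \<open>1\<close>, and the determinant shows that this entry is \<open>1\<close>, too.
\<close>

theorem SL_generated_by_elementary:
  fixes H :: "('a::comm_ring_1 ^ 'n ^ 'n) set"
  assumes local: "\<And>x y :: 'a. \<not> x dvd 1 \<Longrightarrow> \<not> y dvd 1 \<Longrightarrow> \<not> x + y dvd 1"
    and one: "mat 1 \<in> H" and mult: "\<And>A B. A \<in> H \<Longrightarrow> B \<in> H \<Longrightarrow> A ** B \<in> H"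
    and elem: "\<And>k u. colmat k u \<in> H"
    and "det g = 1"
  shows "g \<in> H"
proof -
  have rowmat: "rowmat k u \<in> H" for k and u :: "'a ^ 'n"
  proof (induction u rule: vec_axis_induct)
    case (2 i c)
    show ?case
    proof (cases "i = k")
      case True
      then have "rowmat k (axis i c) = mat 1"
        by (simp add: rowmat_def colmat_axis_self)
      then show ?thesis by (simp add: one)
    qed (simp add: rowmat_axis elem)
  qed (simp_all add: rowmat_def[of _ 0] colmat_0 one rowmat_add mult)
  have col: "g \<in> H" if "colmat k u ** g \<in> H" for k u g
  proof -
    have "colmat k (- u) ** (colmat k u ** g) = g"
      by (simp add: matrix_mul_assoc colmat_0 flip: colmat_add)
    then show ?thesis using mult[OF elem that] by metis
  qed
  have row: "g \<in> H" if "g ** rowmat k u \<in> H" for k u g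
  proof -
    have "(g ** rowmat k u) ** rowmat k (- u) = g"
      by (simp add: colmat_0 rowmat_def[of _ 0] flip: matrix_mul_assoc rowmat_add)
    then show ?thesis using mult[OF that rowmat] by metis
  qed
  have "g \<in> H"
    if "finite C" "det g = 1" "\<And>i j. i \<notin> C \<Longrightarrow> g $ i $ j = (if i = j then 1 else 0) \<and> g $ j $ i = (if i = j then 1 else 0)"
    for C g
    using that
  proof (induction C arbitrary: g rule: finite_psubset_induct)
    case (psubset C)
    note fin = psubset.prems(2)
    show ?case
    proof (cases "\<exists>i\<in>C. \<exists>j\<in>C. i \<noteq> j")
      case False
      then have diag: "i \<noteq> j \<Longrightarrow> g $ i $ j = 0" for i j
        using fin[of i j] fin[of j i] by auto
      then have "(\<Prod>i\<in>UNIV. g $ i $ i) = 1"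
        using det_diagonal[of g] psubset.prems(1) by simp
      moreover have "(\<Prod>i\<in>UNIV. g $ i $ i) = g $ l $ l" if "l \<in> C" for l
      proof -
        have "g $ i $ i = 1" if "i \<noteq> l" for i
          using fin[of i i] False that \<open>l \<in> C\<close> by auto
        then have "(\<Prod>i\<in>UNIV - {l}. g $ i $ i) = 1"
          by (intro prod.neutral) auto
        then show ?thesis by (simp add: prod.remove[of UNIV l])
      qed
      ultimately have "g $ l $ l = 1" for l
        using fin[of l l] by (cases "l \<in> C") auto
      then have "g = mat 1"
        using diag by (simp add: vec_eq_iff mat_def)
      then show ?thesis by (simp add: one)
    next
      case True
      then obtain i j0 where ij0: "i \<in> C" "j0 \<in> C" "i \<noteq> j0" by blast
      define finished :: "'a ^ 'n ^ 'n \<Rightarrow> bool" where "finished h \<longleftrightarrow>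
        (\<forall>a b. a \<notin> C \<longrightarrow> h $ a $ b = (if a = b then 1 else 0) \<and> h $ b $ a = (if a = b then 1 else 0))" for h
      have "finished g"
        using fin by (simp add: finished_def)
      have "\<exists>j h. j \<in> C \<and> j \<noteq> i \<and> det h = 1 \<and> (h \<in> H \<longrightarrow> g \<in> H) \<and> h $ j $ i dvd 1 \<and> finished h"
      proof -
        obtain l where l: "g $ l $ i dvd 1"
          using unit_entry_in_column[OF local psubset.prems(1)] by blast
        have "l \<in> C"
        proof (rule ccontr)
          assume "l \<notin> C"
          then have "g $ l $ i = 0"
            using fin[of l i] ij0(1) by auto
          with l show False by simp
        qed
        show ?thesis
        \<comment> \<open>If the only unit is on the diagonal, a row operation produces a \<open>1\<close> in row \<open>j0\<close>.\<close>
        proof (cases "l = i")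
          case False
          with l \<open>l \<in> C\<close> psubset.prems(1) \<open>finished g\<close> show ?thesis by blast
        next
          case True
          with l obtain c where c: "1 = g $ i $ i * c" by (auto elim: dvdE)
          let ?h = "colmat i (axis j0 (c * (1 - g $ j0 $ i))) ** g"
          have "?h $ j0 $ i = g $ j0 $ i + (g $ i $ i * c) * (1 - g $ j0 $ i)"
            using ij0(3) by (simp add: colmat_mult_nth algebra_simps)
          then have "?h $ j0 $ i dvd 1" by (simp flip: c)
          moreover have "?h $ a $ b = (if a = b then 1 else 0) \<and> ?h $ b $ a = (if a = b then 1 else 0)"
            if "a \<notin> C" for a b
            using that fin[OF that, of b] fin[OF that, of i] ij0
            by (auto simp: colmat_mult_nth axis_def)
          then have "finished ?h"
            unfolding finished_def by blast
          moreover have "det ?h = 1"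
            by (simp add: det_mul det_colmat psubset.prems(1))
          moreover have "?h \<in> H \<longrightarrow> g \<in> H"
            using col by blast
          ultimately show ?thesis
            using ij0(2,3) by blast
        qed
      qed
      then obtain j h where j: "j \<in> C" "j \<noteq> i" and h: "det h = 1" "h \<in> H \<Longrightarrow> g \<in> H" "h $ j $ i dvd 1"
        and "finished h"
        by blast
      then have h_fin: "h $ a $ b = (if a = b then 1 else 0) \<and> h $ b $ a = (if a = b then 1 else 0)"
        if "a \<notin> C" for a b
        using that unfolding finished_def by blast
      obtain c where c: "1 = h $ j $ i * c" using h(3) by (auto elim: dvdE)
      define h1 where "h1 = colmat j (axis i (c * (1 - h $ i $ i))) ** h"
      have "h1 $ i $ i = h $ i $ i + (h $ j $ i * c) * (1 - h $ i $ i)"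
        using j by (simp add: h1_def colmat_mult_nth algebra_simps)
      then have h1_ii: "h1 $ i $ i = 1" by (simp flip: c)
      have h1_fin: "h1 $ a $ b = (if a = b then 1 else 0) \<and> h1 $ b $ a = (if a = b then 1 else 0)"
        if "a \<notin> C" for a b
        using that h_fin[OF that, of b] h_fin[OF that, of j] ij0 j
        by (auto simp: h1_def colmat_mult_nth axis_def)
      define h2 where "h2 = colmat i (\<chi> a. - h1 $ a $ i) ** h1"
      have h2_col: "h2 $ a $ i = (if a = i then 1 else 0)" for a
        by (simp add: h2_def colmat_mult_nth h1_ii)
      have h2_fin: "h2 $ a $ b = (if a = b then 1 else 0) \<and> h2 $ b $ a = (if a = b then 1 else 0)"
        if "a \<notin> C" for a b
        using that h1_fin[OF that, of b] h1_fin[OF that, of i] ij0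
        by (auto simp: h2_def colmat_mult_nth)
      define h3 where "h3 = h2 ** rowmat i (\<chi> b. - h2 $ i $ b)"
      have h3_nth: "h3 $ a $ b = h2 $ a $ b - (if b \<noteq> i \<and> a = i then h2 $ i $ b else 0)" for a b
        by (simp add: h3_def mult_rowmat_nth h2_col)
      have "h3 \<in> H"
      proof (rule psubset.IH[of "C - {i}"])
        show "C - {i} \<subset> C" using ij0(1) by blast
        show "det h3 = 1"
          by (simp add: h3_def h2_def h1_def det_mul det_colmat rowmat_def h(1))
        show "h3 $ a $ b = (if a = b then 1 else 0) \<and> h3 $ b $ a = (if a = b then 1 else 0)"
          if "a \<notin> C - {i}" for a b
        proof (cases "a = i")
          case True
          then show ?thesis using h2_col[of b] h2_col[of i] by (auto simp: h3_nth)
        next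
          case False
          with that have "a \<notin> C" by blast
          then show ?thesis
            using h2_fin[of a b] h2_fin[of a i] False by (auto simp: h3_nth)
        qed
      qed
      then show ?thesis
        using row col h(2) unfolding h3_def h2_def h1_def by blast
    qed
  qed
  from this[of UNIV g] assms(5) show ?thesis by simp
qed

section \<open>Representations of the special linear group\<close>

definition diagmat :: "'a::comm_ring_1 ^ 'n \<Rightarrow> 'a ^ 'n ^ 'n" where
  "diagmat d = (\<chi> a b. if a = b then d $ a else 0)"

lemma diagmat_mult_nth: "(diagmat d ** A) $ a $ b = d $ a * A $ a $ b"
proof -
  have "(diagmat d ** A) $ a $ b = (\<Sum>l\<in>UNIV. if l = a then d $ a * A $ a $ b else 0)"
    unfolding matrix_matrix_mult_def diagmat_def vec_lambda_beta by (rule sum.cong) auto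
  then show ?thesis by simp
qed

lemma mult_diagmat_nth: "(A ** diagmat d) $ a $ b = A $ a $ b * d $ b"
proof -
  have "(A ** diagmat d) $ a $ b = (\<Sum>l\<in>UNIV. if l = b then A $ a $ b * d $ b else 0)"
    unfolding matrix_matrix_mult_def diagmat_def vec_lambda_beta by (rule sum.cong) auto
  then show ?thesis by simp
qed

lemma det_diagmat: "det (diagmat d) = (\<Prod>i\<in>UNIV. d $ i)"
  by (subst det_diagonal) (auto simp: diagmat_def)

lemma colmat_conj_elementary:
  assumes "i \<noteq> k" "j \<noteq> k" "i \<noteq> j"
  shows "colmat j (axis i c) ** colmat k u = colmat k (u + axis i (c * u $ j)) ** colmat j (axis i c)"
  using assms
  by (auto simp: vec_eq_iff colmat_mult_nth mult_colmat_axis_nth)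
    (auto simp: colmat_def axis_def)

lemma colmat_conj_diagmat:
  assumes "d $ k * e = 1"
  shows "diagmat d ** colmat k u = colmat k (\<chi> a. d $ a * u $ a * e) ** diagmat d"
proof -
  have "d $ a * u $ a * e * d $ k = d $ a * u $ a" for a
    using assms by (metis mult.assoc mult.commute mult.right_neutral)
  then show ?thesis
    by (auto simp: vec_eq_iff diagmat_mult_nth mult_diagmat_nth colmat_def distrib_left distrib_right)
qed

text \<open>An invertible idempotent matrix is the identity.\<close>

lemma representation_one:
  assumes "\<rho> \<in> hom G GL" "mat 1 \<in> carrier G" "mult G = (**)"
  shows "\<rho> (mat 1) = mat 1"
proof -
  let ?E = "\<rho> (mat 1)"
  have "?E ** ?E = ?E"
    using assms by (auto simp: hom_def GL_def dest!: bspec[of _ _ "mat 1"])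
  moreover obtain E' where "E' ** ?E = mat 1"
    using assms by (force simp: hom_def GL_def invertible_def)
  ultimately show ?thesis
    by (metis matrix_mul_assoc matrix_mul_lid)
qed

lemma SL_simps: "carrier SL = {A. det A = 1}" "mult SL = (**)"
  by (simp_all add: SL_def GL_def)

lemma hom_GL_invertible: "\<rho> \<in> hom G GL \<Longrightarrow> A \<in> carrier G \<Longrightarrow> invertible (\<rho> A)"
  by (auto simp: hom_def GL_def)

lemma ex_third_index:
  fixes i k :: "'n::finite"
  assumes "CARD('n) \<ge> 3"
  shows "\<exists>j. j \<noteq> i \<and> j \<noteq> k"
proof (rule ccontr)
  assume "\<not> ?thesis"
  then have "CARD('n) \<le> card {i, k}"
    by (intro card_mono) auto
  also have "\<dots> \<le> 2" by (simp add: card_insert_if)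
  finally show False using assms by simp
qed

text \<open>
  Generation by one-column matrices provides a column \<open>k\<close> on which the representation is
  non-trivial. The set \<open>S\<close> is the spectrum of the first non-trivial layer of that column subgroup.
  Elementary matrices that avoid row and column \<open>k\<close> act on it by shears. The diagonal matrix with
  entries \<open>\<tau>\<close> at \<open>i\<close> and \<open>1 / \<tau>\<close> at \<open>k\<close> multiplies entry \<open>i\<close> of the column by \<open>\<tau>\<^sup>2\<close>.
\<close>

theorem SL_spectrum:
  fixes \<rho> :: "'p::prime_card padic_int ^ 'n ^ 'n \<Rightarrow> complex ^ 'd ^ 'd"
  assumes cont: "continuous_representation SL \<rho>" and nontriv: "nontrivial_representation SL \<rho>"
  obtains k :: 'n and S :: "('p mod_ring ^ 'n) set" where
    "card S \<le> CARD('d)"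
    "\<exists>a\<in>S. \<exists>i. i \<noteq> k \<and> a $ i \<noteq> 0"
    "\<And>a i j c. a \<in> S \<Longrightarrow> i \<noteq> k \<Longrightarrow> j \<noteq> k \<Longrightarrow> i \<noteq> j \<Longrightarrow> a $ i \<noteq> 0 \<Longrightarrow> a + axis j c \<in> S"
    "\<And>a i t. a \<in> S \<Longrightarrow> i \<noteq> k \<Longrightarrow> t \<noteq> 0 \<Longrightarrow> \<exists>b\<in>S. b $ i = t * t * a $ i"
proof -
  have hom: "\<rho> \<in> hom SL GL"
    using cont by (simp add: continuous_representation_def)
  have \<rho>_mult: "\<rho> (A ** B) = \<rho> A ** \<rho> B" if "det A = 1" "det B = 1" for A B
    using hom that by (auto simp: hom_def SL_simps GL_def)
  have \<rho>_inv: "invertible (\<rho> A)" if "det A = 1" for A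
    using hom_GL_invertible[OF hom] that by (simp add: SL_simps)
  have \<rho>_1: "\<rho> (mat 1) = mat 1"
    by (rule representation_one[OF hom]) (simp_all add: SL_simps)
  have "\<exists>k u. \<rho> (colmat k u) \<noteq> mat 1"
  proof (rule ccontr)
    assume "\<not> ?thesis"
    then have triv: "\<rho> (colmat k u) = mat 1" for k u by blast
    have "A \<in> {A. det A = 1 \<and> \<rho> A = mat 1}" if "det A = 1" for A
      by (rule SL_generated_by_elementary[OF nonunit_padic_add _ _ _ that])
        (simp_all add: \<rho>_1 det_mul det_colmat \<rho>_mult triv)
    then show False
      using nontriv by (auto simp: nontrivial_representation_def SL_simps)
  qed
  then obtain k u0 where ku0: "\<rho> (colmat k u0) \<noteq> mat 1" by blast
  define \<Phi> where "\<Phi> u = \<rho> (colmat k u)" for u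
  interpret padic_hom \<Phi>
    by unfold_locales (simp_all add: \<Phi>_def colmat_0 colmat_add \<rho>_1 \<rho>_mult det_colmat)
  obtain N where N: "\<And>A. det A = 1 \<Longrightarrow> (\<forall>i j. A $ i $ j - mat 1 $ i $ j \<in> pideal N) \<Longrightarrow> mnorm (\<rho> A - mat 1) \<le> 1 / 2"
    using continuous_representation_near_one[OF cont _ \<rho>_1] by (auto simp: SL_simps)
  have "mnorm (\<Phi> u - mat 1) \<le> 1 / 2" if "\<forall>i. u $ i \<in> pideal N" for u
    unfolding \<Phi>_def by (rule N[OF det_colmat]) (use that in \<open>auto simp: colmat_def mat_def\<close>)
  with exact_level[of u0] ku0 obtain n where
    triv: "\<And>u. (\<forall>i. u $ i \<in> pideal (Suc n)) \<Longrightarrow> \<Phi> u = mat 1"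
    and rep: "elementary_rep (\<lambda>v. \<Phi> (lift_digit n v))"
    and nontriv_n: "\<exists>v. \<Phi> (lift_digit n v) \<noteq> mat 1"
    unfolding \<Phi>_def[of u0, symmetric] by blast
  define S where "S = elementary_rep.spectrum (\<lambda>v. \<Phi> (lift_digit n v))"
  have "card S \<le> CARD('d)"
    unfolding S_def by (rule elementary_rep.card_spectrum_le[OF rep])
  moreover have "\<exists>a\<in>S. \<exists>i. i \<noteq> k \<and> a $ i \<noteq> 0"
  proof -
    obtain v where v: "\<Phi> (lift_digit n v) \<noteq> mat 1" using nontriv_n by blast
    \<comment> \<open>Column matrices ignore coordinate \<open>k\<close>, so the detecting coordinate may be taken different from \<open>k\<close>.\<close>
    let ?v = "\<chi> i. if i = k then 0 else v $ i"
    have "\<Phi> (lift_digit n ?v) = \<Phi> (lift_digit n v)"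
      unfolding \<Phi>_def by (rule arg_cong[where f = \<rho>]) (auto simp: vec_eq_iff colmat_def lift_digit_def)
    with v have "\<Phi> (lift_digit n ?v) \<noteq> mat 1" by simp
    from elementary_rep.spectrum_detects[OF rep this]
    obtain a where a: "a \<in> S" "dot a ?v \<noteq> 0"
      unfolding S_def by blast
    then obtain i where "a $ i * ?v $ i \<noteq> 0"
      unfolding dot_def by (meson sum.neutral)
    then show ?thesis
      using a(1) by (auto split: if_splits)
  qed
  moreover have "a + axis j c \<in> S"
    if a: "a \<in> S" and ij: "i \<noteq> k" "j \<noteq> k" "i \<noteq> j" "a $ i \<noteq> 0" for a i j c
  proof -
    let ?s = "- c / a $ i"
    let ?T = "\<rho> (colmat j (axis i (digit 0 ?s)))"
    have "a - axis j (?s * a $ i) \<in> S"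
      unfolding S_def
    proof (rule level_spectrum_shear[OF triv rep])
      show "a \<in> elementary_rep.spectrum (\<lambda>v. \<Phi> (lift_digit n v))"
        using a by (simp add: S_def)
      show "reduces_to n (digit 0 ?s) ?s" by (rule reduces_to_digit)
      show "invertible ?T" by (simp add: \<rho>_inv det_colmat)
      show "?T ** \<Phi> u = \<Phi> (u + axis i (digit 0 ?s * u $ j)) ** ?T" for u
        by (simp add: \<Phi>_def det_colmat colmat_conj_elementary[OF ij(1-3)] flip: \<rho>_mult)
    qed (use ij in auto)
    moreover have "a - axis j (?s * a $ i) = a + axis j c"
      using ij(4) by (simp add: vec_eq_iff axis_def)
    ultimately show ?thesis by (simp only:)
  qed
  moreover have "\<exists>b\<in>S. b $ i = t * t * a $ i" if a: "a \<in> S" and i: "i \<noteq> k" and t: "t \<noteq> 0" for a i t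
  proof -
    \<comment> \<open>The spectrum transforms dually, so the inverse of \<open>t\<close> is used in the matrix.\<close>
    obtain e where e: "1 = digit 0 (1 / t) * e"
      using digit_unit[of "1 / t"] t by (auto elim: dvdE)
    define d :: "'p padic_int ^ 'n" where "d = (\<chi> l. if l = i then digit 0 (1 / t) else if l = k then e else 1)"
    define s where "s l = (if l = i then 1 / t * (1 / t) else if l = k then 1 else 1 / t)" for l
    have d_k: "d $ k * digit 0 (1 / t) = 1"
      using e i by (simp add: d_def mult.commute)
    have "(\<Prod>l\<in>UNIV. d $ l) = (\<Prod>l\<in>{i, k}. d $ l)"
      by (rule prod.mono_neutral_right) (auto simp: d_def)
    then have det: "det (diagmat d) = 1"
      using i by (simp add: det_diagmat) (simp add: d_def flip: e)
    have "(\<chi> l. a $ l / s l) \<in> S"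
      unfolding S_def
    proof (rule level_spectrum_scale[OF triv rep])
      show "a \<in> elementary_rep.spectrum (\<lambda>v. \<Phi> (lift_digit n v))"
        using a by (simp add: S_def)
      show "s l \<noteq> 0" for l using t by (simp add: s_def)
      show "reduces_to n (d $ l * digit 0 (1 / t)) (s l)" for l
      proof (cases "l = k")
        case True
        then show ?thesis using i by (simp add: d_k s_def reduces_to_1)
      next
        case False
        then show ?thesis
          by (simp add: d_def s_def reduces_to_digit reduces_to_mult del: times_divide_eq_right times_divide_eq_left)
      qed
      show "invertible (\<rho> (diagmat d))" by (simp add: \<rho>_inv det)
      show "\<rho> (diagmat d) ** \<Phi> u = \<Phi> (\<chi> l. d $ l * digit 0 (1 / t) * u $ l) ** \<rho> (diagmat d)" for u
        using colmat_conj_diagmat[OF d_k, of u]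
        by (simp add: \<Phi>_def det_colmat det mult_ac flip: \<rho>_mult)
    qed
    then show ?thesis
      by (rule bexI[rotated]) (use t in \<open>simp add: s_def\<close>)
  qed
  ultimately show ?thesis by (rule that)
qed

theorem SL_degree_torus:
  fixes \<rho> :: "'p::prime_card padic_int ^ 'n ^ 'n \<Rightarrow> complex ^ 'd ^ 'd"
  assumes "continuous_representation SL \<rho>" "nontrivial_representation SL \<rho>"
  shows "CARD('p) - 1 \<le> 2 * CARD('d)"
proof -
  obtain k :: 'n and S :: "('p mod_ring ^ 'n) set" where S: "card S \<le> CARD('d)"
    "\<exists>a\<in>S. \<exists>i. i \<noteq> k \<and> a $ i \<noteq> 0"
    "\<And>a i t. a \<in> S \<Longrightarrow> i \<noteq> k \<Longrightarrow> t \<noteq> 0 \<Longrightarrow> \<exists>b\<in>S. b $ i = t * t * a $ i"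
    by (rule SL_spectrum[OF assms]) blast
  obtain a i where a: "a \<in> S" "i \<noteq> k" "a $ i \<noteq> 0" using S(2) by blast
  have "{t * t * a $ i |t. t \<noteq> 0} \<subseteq> (\<lambda>b. b $ i) ` S"
    using S(3)[OF a(1,2)] by force
  then have "card {t * t * a $ i |t. t \<noteq> 0} \<le> card S"
    by (rule surj_card_le[rotated]) simp
  then show ?thesis
    using card_square_multiples[OF a(3)] S(1) by linarith
qed

text \<open>
  With a third index \<open>j\<close> available, a shear first makes coordinate \<open>j\<close> equal to \<open>1\<close>, and a shear in
  the opposite direction then gives coordinate \<open>i\<close> any value. Hence no squares are involved and the
  factor \<open>1 / 2\<close> disappears.
\<close>

theorem SL_degree:
  fixes \<rho> :: "'p::prime_card padic_int ^ 'n ^ 'n \<Rightarrow> complex ^ 'd ^ 'd"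
  assumes "CARD('n) \<ge> 3"
    and "continuous_representation SL \<rho>" "nontrivial_representation SL \<rho>"
  shows "(CARD('p) - 1) * CARD('p) ^ (CARD('n) - 2) \<le> CARD('d)"
proof -
  obtain k :: 'n and S :: "('p mod_ring ^ 'n) set" where S: "card S \<le> CARD('d)"
    "\<exists>a\<in>S. \<exists>i. i \<noteq> k \<and> a $ i \<noteq> 0"
    and shear: "\<And>a i j c. a \<in> S \<Longrightarrow> i \<noteq> k \<Longrightarrow> j \<noteq> k \<Longrightarrow> i \<noteq> j \<Longrightarrow> a $ i \<noteq> 0 \<Longrightarrow> a + axis j c \<in> S"
    by (rule SL_spectrum[OF assms(2,3)]) blast
  obtain a i where a: "a \<in> S" "i \<noteq> k" "a $ i \<noteq> 0" using S(2) by blast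
  obtain j where j: "j \<noteq> i" "j \<noteq> k" using ex_third_index[OF assms(1)] by blast
  have W: "UNIV - {0} \<subseteq> (\<lambda>a. a $ i) ` S - {0}"
  proof
    fix w :: "'p mod_ring" assume w: "w \<in> UNIV - {0}"
    define b where "b = a + axis j (1 - a $ j)"
    have b: "b \<in> S" "b $ j \<noteq> 0"
      using shear[OF a(1,2) j(2) _ a(3)] j(1) by (auto simp: b_def axis_def)
    have "b + axis i (w - b $ i) \<in> S"
      using b a(2) j by (intro shear) auto
    moreover have "(b + axis i (w - b $ i)) $ i = w" by (simp add: axis_def)
    ultimately show "w \<in> (\<lambda>a. a $ i) ` S - {0}" using w by force
  qed
  have "card (UNIV - {0 :: 'p mod_ring}) * CARD('p mod_ring) ^ card (UNIV - {i, k}) \<le> card S"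
    by (rule card_ge_of_shears[OF _ _ W]) (use a(2) in \<open>auto intro: shear\<close>)
  moreover have "card (UNIV - {i, k}) = CARD('n) - 2"
    using a(2) by (simp add: card_Diff_subset)
  ultimately show ?thesis
    using S(1) by (simp add: card_Diff_singleton)
qed

section \<open>Transvections and the symplectic group\<close>

\<comment> \<open>This simplification rule would turn products with transposed matrices into row-vector products.\<close>
declare transpose_matrix_vector [simp del]

text \<open>
  Vectors of length \<open>2 k\<close> are handled as pairs of vectors of length \<open>k\<close>, and matrix identities are
  checked by applying both sides to such pairs.
\<close>

definition stack :: "'a ^ 'k \<Rightarrow> 'a ^ 'k \<Rightarrow> 'a ^ ('k::finite + 'k)" where
  "stack u w = (\<chi> i. case i of Inl a \<Rightarrow> u $ a | Inr a \<Rightarrow> w $ a)"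

lemma stack_nth [simp]: "stack u w $ Inl a = u $ a" "stack u w $ Inr a = w $ a"
  by (simp_all add: stack_def)

lemma vec_sum_eq_iff:
  "(x :: 'a ^ ('k::finite + 'k)) = y \<longleftrightarrow> (\<forall>a. x $ Inl a = y $ Inl a) \<and> (\<forall>a. x $ Inr a = y $ Inr a)"
  unfolding vec_eq_iff by (metis sum.exhaust)

lemma stack_cases:
  fixes x :: "'a ^ ('k::finite + 'k)"
  obtains u w where "x = stack u w"
proof
  show "x = stack (\<chi> a. x $ Inl a) (\<chi> a. x $ Inr a)"
    by (simp add: vec_sum_eq_iff)
qed

lemma sum_over_sum_type:
  fixes f :: "'k::finite + 'k \<Rightarrow> 'b::comm_monoid_add"
  shows "sum f UNIV = (\<Sum>a\<in>UNIV. f (Inl a)) + (\<Sum>a\<in>UNIV. f (Inr a))"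
proof -
  have "sum f UNIV = sum f (UNIV <+> UNIV)"
    by (simp only: UNIV_Plus_UNIV)
  also have "\<dots> = (\<Sum>a\<in>UNIV. f (Inl a)) + (\<Sum>a\<in>UNIV. f (Inr a))"
    by (subst sum.Plus) (simp_all add: comp_def)
  finally show ?thesis .
qed

lemma dot_stack: "dot (stack u w) (stack u' w') = dot u u' + dot w w'"
  by (simp add: dot_def sum_over_sum_type)

lemma dot_matrix_vector: "dot u (A *v w) = dot (transpose A *v u) w"
  for A :: "'a::comm_ring_1 ^ 'n ^ 'm"
proof -
  have "dot u (A *v w) = (\<Sum>i\<in>UNIV. \<Sum>j\<in>UNIV. u $ i * (A $ i $ j * w $ j))"
    by (simp add: dot_def matrix_vector_mult_def sum_distrib_left)
  also have "\<dots> = (\<Sum>j\<in>UNIV. \<Sum>i\<in>UNIV. u $ i * (A $ i $ j * w $ j))"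
    by (rule sum.swap)
  also have "\<dots> = dot (transpose A *v u) w"
    by (simp add: dot_def matrix_vector_mult_def transpose_def sum_distrib_left sum_distrib_right mult_ac)
  finally show ?thesis .
qed

lemma dot_eqI:
  fixes u v :: "'a::comm_ring_1 ^ 'm"
  assumes "\<And>w. dot u w = dot v w"
  shows "u = v"
proof (rule vec_eq_iff[THEN iffD2, rule_format])
  fix i show "u $ i = v $ i"
    using assms[of "axis i 1"] by (simp add: dot_axis)
qed

lemma matrix_vector_scale: "A *v (c *s x) = c *s (A *v x)"
  for A :: "'a::comm_ring_1 ^ 'n ^ 'm"
  by (simp add: vec_eq_iff matrix_vector_mult_def sum_distrib_left mult_ac)

lemma matrix_vector_neg: "A *v (- x) = - (A *v x)"
  for A :: "'a::comm_ring_1 ^ 'n ^ 'm"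
  by (simp add: vec_eq_iff matrix_vector_mult_def sum_negf)

definition sympl_form :: "'a::comm_ring_1 ^ ('k::finite + 'k) \<Rightarrow> 'a ^ ('k + 'k) \<Rightarrow> 'a" where
  "sympl_form x y = dot x (symplectic_J *v y)"

lemma symplectic_J_mult_stack:
  fixes u w :: "'a::comm_ring_1 ^ 'k::finite"
  shows "symplectic_J *v stack u w = stack w (- u)"
proof -
  have "(\<Sum>b\<in>UNIV. mat 1 $ a $ b * v $ b) = v $ a" for v :: "'a ^ 'k" and a
    using matrix_vector_mul_lid[of v] by (simp add: matrix_vector_mult_def vec_eq_iff)
  then show ?thesis
    by (simp add: vec_sum_eq_iff matrix_vector_mult_def sum_over_sum_type symplectic_J_def sum_negf)
qed

lemma sympl_form_stack: "sympl_form (stack u w) (stack u' w') = dot u w' - dot w u'"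
  by (simp add: sympl_form_def symplectic_J_mult_stack dot_stack) (simp add: dot_def sum_negf)

lemma sympl_form_right_add: "sympl_form x (y + z) = sympl_form x y + sympl_form x z"
  by (simp add: sympl_form_def matrix_vector_right_distrib dot_add_right)

lemma sympl_form_right_scale: "sympl_form x (c *s y) = c * sympl_form x y"
  by (simp add: sympl_form_def matrix_vector_scale dot_def sum_distrib_left mult_ac)

lemma sympl_form_skew: "sympl_form y x = - sympl_form x y"
proof -
  obtain u w u' w' where "x = stack u w" "y = stack u' w'" by (metis stack_cases)
  then show ?thesis by (simp add: sympl_form_stack dot_commute)
qed

lemma sympl_form_left_add: "sympl_form (x + y) z = sympl_form x z + sympl_form y z"
  by (metis sympl_form_skew sympl_form_right_add minus_add_distrib)

lemma sympl_form_left_scale: "sympl_form (c *s x) y = c * sympl_form x y"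
  by (metis sympl_form_skew sympl_form_right_scale minus_mult_right)

lemma sympl_form_self [simp]: "sympl_form x x = 0"
proof -
  obtain u w where "x = stack u w" by (metis stack_cases)
  then show ?thesis by (simp add: sympl_form_stack dot_commute)
qed

lemma sympl_form_left_diff: "sympl_form (x - y) z = sympl_form x z - sympl_form y z"
  using sympl_form_left_add[of "x - y" y z] by simp

lemma matrix_eq_vec:
  fixes A B :: "'a::comm_ring_1 ^ 'n ^ 'm"
  assumes "\<And>x. A *v x = B *v x"
  shows "A = B"
  using assms by (simp add: matrix_eq)

lemma symplectic_J_squared: "symplectic_J *v (symplectic_J *v x) = - x"
proof -
  obtain u w where x: "x = stack u w" by (metis stack_cases)
  have "symplectic_J *v (symplectic_J *v x) = stack (- u) (- w)"
    by (simp only: x symplectic_J_mult_stack)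
  then show ?thesis by (simp only: x) (simp add: vec_sum_eq_iff)
qed

text \<open>
  The group is defined by \<open>A J A\<^sup>T = J\<close>, whereas preservation of the form reads \<open>A\<^sup>T J A = J\<close>. The
  latter says \<open>A\<^sup>T (J A J) = - 1\<close>, because \<open>J\<^sup>2 = - 1\<close>. As \<open>A\<^sup>T\<close> is invertible, the two factors may be
  interchanged, and multiplication by \<open>J\<close> turns the result into the former.
\<close>

lemma symplectic_J_transpose_form:
  fixes A :: "'a::comm_ring_1 ^ ('k::finite + 'k) ^ ('k + 'k)"
  assumes "invertible A" and J: "transpose A ** symplectic_J ** A = symplectic_J"
  shows "A ** symplectic_J ** transpose A = symplectic_J"
proof -
  obtain B where B: "A ** B = mat 1" "B ** A = mat 1"
    using assms(1) unfolding invertible_def by blast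
  have AtB: "transpose B *v (transpose A *v x) = x" for x
    using B(1) by (metis matrix_transpose_mul matrix_vector_mul_assoc matrix_vector_mul_lid transpose_mat)
  have *: "symplectic_J *v (A *v x) = transpose B *v (symplectic_J *v x)" for x
  proof -
    have "symplectic_J *v (A *v x) = transpose B *v (transpose A *v (symplectic_J *v (A *v x)))"
      by (simp add: AtB)
    also have "transpose A *v (symplectic_J *v (A *v x)) = symplectic_J *v x"
      by (metis J matrix_vector_mul_assoc)
    finally show ?thesis .
  qed
  show ?thesis
  proof (rule matrix_eq_vec)
    fix x
    have "symplectic_J *v (A *v (symplectic_J *v (transpose A *v x))) = - x"
      by (simp add: * symplectic_J_squared matrix_vector_neg AtB)
    then have "symplectic_J *v (symplectic_J *v (A *v (symplectic_J *v (transpose A *v x)))) = symplectic_J *v (- x)"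
      by simp
    then have "A *v (symplectic_J *v (transpose A *v x)) = symplectic_J *v x"
      by (simp add: symplectic_J_squared matrix_vector_neg)
    then show "(A ** symplectic_J ** transpose A) *v x = symplectic_J *v x"
      by (simp add: matrix_vector_mul_assoc matrix_mul_assoc)
  qed
qed

lemma Sp_simps: "mult Sp = (**)" "A \<in> carrier Sp \<Longrightarrow> invertible A"
  by (simp_all add: Sp_def GL_def)

lemma Sp_iff_preserves_symp:
  "A \<in> carrier Sp \<longleftrightarrow> invertible A \<and> (\<forall>x y. sympl_form (A *v x) (A *v y) = sympl_form x y)"
proof -
  have pull: "sympl_form (A *v x) (A *v y) = dot x (transpose A *v (symplectic_J *v (A *v y)))" for x y
    by (simp add: sympl_form_def dot_matrix_vector[of x "transpose A"])
  have form: "(\<forall>x y. sympl_form (A *v x) (A *v y) = sympl_form x y) \<longleftrightarrow> transpose A ** symplectic_J ** A = symplectic_J"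
    (is "?L \<longleftrightarrow> ?R")
  proof
    assume ?R
    then have "transpose A *v (symplectic_J *v (A *v y)) = symplectic_J *v y" for y
      by (metis matrix_vector_mul_assoc)
    then show ?L
      by (simp add: pull) (simp add: sympl_form_def)
  next
    assume L: ?L
    show ?R
    proof (rule matrix_eq_vec, rule dot_eqI)
      fix y x
      have "dot x (transpose A *v (symplectic_J *v (A *v y))) = dot x (symplectic_J *v y)"
        using L by (simp add: sympl_form_def flip: pull)
      then show "dot ((transpose A ** symplectic_J ** A) *v y) x = dot (symplectic_J *v y) x"
        by (simp add: dot_commute[of _ x] matrix_vector_mul_assoc matrix_mul_assoc)
    qed
  qed
  have "invertible A \<Longrightarrow> invertible (transpose A)"
    unfolding invertible_def by (metis matrix_transpose_mul transpose_mat)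
  then show ?thesis
    using symplectic_J_transpose_form[of A] symplectic_J_transpose_form[of "transpose A"]
    unfolding form by (auto simp: Sp_def GL_def)
qed

lemma Sp_mult: "A \<in> carrier Sp \<Longrightarrow> B \<in> carrier Sp \<Longrightarrow> A ** B \<in> carrier Sp"
  by (simp add: Sp_iff_preserves_symp invertible_mult flip: matrix_vector_mul_assoc)

lemma Sp_one: "mat 1 \<in> carrier Sp"
  unfolding Sp_iff_preserves_symp by (auto simp: invertible_def)

text \<open>The symplectic transvection \<open>x \<mapsto> x + c \<langle>v, x\<rangle> v\<close>.\<close>

definition transvec :: "'a::comm_ring_1 ^ ('k::finite + 'k) \<Rightarrow> 'a \<Rightarrow> 'a ^ ('k + 'k) ^ ('k + 'k)" where
  "transvec v c = (\<chi> i j. mat 1 $ i $ j - c * v $ i * (symplectic_J *v v) $ j)"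

lemma transvec_mult_vec: "transvec v c *v x = x + (c * sympl_form v x) *s v"
proof -
  have "transvec v c *v x = x + (c * - dot (symplectic_J *v v) x) *s v"
  proof (rule vec_eq_iff[THEN iffD2, rule_format])
    fix i
    have "(transvec v c *v x) $ i = (mat 1 *v x) $ i - (\<Sum>j\<in>UNIV. c * v $ i * (symplectic_J *v v) $ j * x $ j)"
      by (simp add: matrix_vector_mult_def transvec_def left_diff_distrib sum_subtractf)
    then show "(transvec v c *v x) $ i = (x + (c * - dot (symplectic_J *v v) x) *s v) $ i"
      by (simp add: dot_def sum_distrib_left mult_ac)
  qed
  moreover have "dot (symplectic_J *v v) x = - sympl_form v x"
    by (metis sympl_form_def sympl_form_skew dot_commute)
  ultimately show ?thesis by simp
qed

lemma transvec_add: "transvec v c ** transvec v d = transvec v (c + d)"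
  by (rule matrix_eq_vec)
    (simp add: transvec_mult_vec sympl_form_right_add sympl_form_right_scale vector_sadd_rdistrib
      algebra_simps flip: matrix_vector_mul_assoc)

lemma transvec_0: "transvec v 0 = mat 1"
  by (rule matrix_eq_vec) (simp add: transvec_mult_vec)

lemma transvec_Sp: "transvec v c \<in> carrier Sp"
  unfolding Sp_iff_preserves_symp
proof (intro conjI allI)
  show "invertible (transvec v c)"
    unfolding invertible_def using transvec_add[of v c "- c"] transvec_add[of v "- c" c]
    by (auto simp: transvec_0)
  show "sympl_form (transvec v c *v x) (transvec v c *v y) = sympl_form x y" for x y
    by (simp add: transvec_mult_vec sympl_form_right_add sympl_form_left_add sympl_form_right_scale sympl_form_left_scale
        sympl_form_skew[of x v] algebra_simps)
qed

lemma transvec_conj: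
  assumes "g \<in> carrier Sp"
  shows "g ** transvec v c = transvec (g *v v) c ** g"
  using assms
  by (intro matrix_eq_vec)
    (simp add: transvec_mult_vec matrix_vector_right_distrib matrix_vector_scale Sp_iff_preserves_symp
      flip: matrix_vector_mul_assoc)

text \<open>
  The direction must be \<open>y - x\<close>, and \<open>\<langle>y - x, x\<rangle> = \<langle>y, x\<rangle>\<close> is a unit, so the parameter can be
  chosen to make the displacement exactly \<open>y - x\<close>.
\<close>

lemma transvec_move:
  assumes "sympl_form x y dvd 1"
  shows "\<exists>c. transvec (y - x) c *v x = y"
proof -
  from assms obtain d where d: "1 = sympl_form x y * d" by (rule dvdE)
  have "transvec (y - x) (- d) *v x = x + (sympl_form x y * d) *s (y - x)"
    by (simp add: transvec_mult_vec sympl_form_left_diff sympl_form_skew[of y x] mult.commute)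
  then have "transvec (y - x) (- d) *v x = y" by (simp flip: d)
  then show ?thesis by blast
qed

lemma transvec_fixes: "sympl_form v u = 0 \<Longrightarrow> transvec v c *v u = u"
  by (simp add: transvec_mult_vec)

text \<open>
  In a local ring, if neither \<open>z1\<close> nor \<open>z2\<close> pairs to a unit with both vectors, then \<open>z1 + z2\<close> does:
  each of its two pairings is a unit plus a non-unit.
\<close>

lemma common_partner:
  fixes x y z1 z2 :: "'a::comm_ring_1 ^ ('k::finite + 'k)"
  assumes local: "\<And>x y :: 'a. \<not> x dvd 1 \<Longrightarrow> \<not> y dvd 1 \<Longrightarrow> \<not> x + y dvd 1"
    and z: "sympl_form x z1 dvd 1" "sympl_form z2 y dvd 1"
  shows "\<exists>z\<in>{z1, z2, z1 + z2}. sympl_form x z dvd 1 \<and> sympl_form z y dvd 1"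
proof (cases "sympl_form z1 y dvd 1 \<or> sympl_form x z2 dvd 1")
  case True
  then show ?thesis using z by auto
next
  case False
  have "sympl_form x z1 + sympl_form x z2 dvd 1"
  proof (rule ccontr)
    assume n: "\<not> sympl_form x z1 + sympl_form x z2 dvd 1"
    have "\<not> (sympl_form x z1 + sympl_form x z2) + (- sympl_form x z2) dvd 1"
      by (rule local[OF n]) (use False in simp)
    then show False using z(1) by simp
  qed
  moreover have "sympl_form z1 y + sympl_form z2 y dvd 1"
  proof (rule ccontr)
    assume n: "\<not> sympl_form z1 y + sympl_form z2 y dvd 1"
    have "\<not> (sympl_form z1 y + sympl_form z2 y) + (- sympl_form z1 y) dvd 1"
      by (rule local[OF n]) (use False in simp)
    then show False using z(2) by simp
  qed
  ultimately show ?thesis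
    by (simp add: sympl_form_left_add sympl_form_right_add)
qed

definition unimodular :: "'a::comm_ring_1 ^ ('k::finite + 'k) \<Rightarrow> bool" where
  "unimodular v \<longleftrightarrow> (\<exists>z. sympl_form v z dvd 1)"

lemma unimodular_diff:
  assumes "sympl_form x y dvd 1"
  shows "unimodular (y - x)"
proof -
  have "sympl_form (y - x) x = - sympl_form x y"
    by (simp add: sympl_form_left_diff sympl_form_skew[of x y])
  then show ?thesis
    using assms unfolding unimodular_def by (metis minus_dvd_iff)
qed

text \<open>Two transvections suffice, passing through a vector that pairs to a unit with both ends.\<close>

lemma Sp_transitive_unimodular:
  fixes x y :: "'a::comm_ring_1 ^ ('k::finite + 'k)"
  assumes local: "\<And>x y :: 'a. \<not> x dvd 1 \<Longrightarrow> \<not> y dvd 1 \<Longrightarrow> \<not> x + y dvd 1"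
    and "unimodular x" "unimodular y"
  shows "\<exists>g\<in>carrier Sp. g *v x = y"
proof -
  obtain z1 z2 where "sympl_form x z1 dvd 1" "sympl_form y z2 dvd 1"
    using assms unfolding unimodular_def by blast
  then have "sympl_form x z1 dvd 1" "sympl_form z2 y dvd 1"
    by (simp_all add: sympl_form_skew[of y z2])
  from common_partner[OF local this] obtain z where z: "sympl_form x z dvd 1" "sympl_form z y dvd 1"
    by blast
  obtain c d where "transvec (z - x) c *v x = z" "transvec (y - z) d *v z = y"
    using transvec_move[OF z(1)] transvec_move[OF z(2)] by blast
  then have "(transvec (y - z) d ** transvec (z - x) c) *v x = y"
    by (simp flip: matrix_vector_mul_assoc)
  then show ?thesis
    using Sp_mult[OF transvec_Sp transvec_Sp] by blast
qed

definition basis_e :: "'k \<Rightarrow> 'a::comm_ring_1 ^ ('k::finite + 'k)" where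
  "basis_e i = stack (axis i 1) 0"

definition basis_f :: "'k \<Rightarrow> 'a::comm_ring_1 ^ ('k::finite + 'k)" where
  "basis_f i = stack 0 (axis i 1)"

lemma sympl_form_basis:
  "sympl_form (basis_e i) (basis_e j) = 0" "sympl_form (basis_f i) (basis_f j) = 0"
  "sympl_form (basis_e i) (basis_f j) = (if i = j then 1 else 0)"
  "sympl_form (basis_f i) (basis_e j) = (if i = j then - 1 else 0)"
  by (auto simp: basis_e_def basis_f_def sympl_form_stack dot_axis) (auto simp: axis_def)

lemma fixes_bases_imp_one:
  fixes g :: "'a::comm_ring_1 ^ ('k::finite + 'k) ^ ('k + 'k)"
  assumes "\<And>i. g *v basis_e i = basis_e i" "\<And>i. g *v basis_f i = basis_f i"
  shows "g = mat 1"
proof -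
  have "g *v axis i 1 = axis i 1" for i :: "'k + 'k"
  proof (cases i)
    case (Inl a)
    have "axis i 1 = (basis_e a :: 'a ^ ('k + 'k))"
      by (simp add: Inl basis_e_def vec_sum_eq_iff) (simp add: axis_def)
    then show ?thesis using assms(1) by simp
  next
    case (Inr a)
    have "axis i 1 = (basis_f a :: 'a ^ ('k + 'k))"
      by (simp add: Inr basis_f_def vec_sum_eq_iff) (simp add: axis_def)
    then show ?thesis using assms(2) by simp
  qed
  moreover have "(A *v axis i 1) $ l = A $ l $ i" for A :: "'a ^ ('k + 'k) ^ ('k + 'k)" and i l
    using dot_axis[of "A $ l" i 1] by (simp add: dot_def matrix_vector_mult_def)
  ultimately have "g $ l $ i = mat 1 $ l $ i" for l i
    by (metis matrix_vector_mul_lid)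
  then show ?thesis
    by (simp add: vec_eq_iff)
qed

text \<open>
  Elimination by hyperbolic pairs. \<open>C\<close> is the set of indices whose basis pair \<open>basis_e i\<close>,
  \<open>basis_f i\<close> is not yet fixed by \<open>g\<close>. Each round moves the image of \<open>basis_e i\<close> back to \<open>basis_e i\<close> by
  at most two transvections and then does the same for \<open>basis_f i\<close>. A transvection fixes the vectors
  orthogonal to its direction, so it is enough that all intermediate vectors have the same pairing with
  the vectors that are to stay fixed.
\<close>

theorem Sp_generated_by_transvections:
  fixes H :: "('a::comm_ring_1 ^ ('k::finite + 'k) ^ ('k + 'k)) set"
  assumes local: "\<And>x y :: 'a. \<not> x dvd 1 \<Longrightarrow> \<not> y dvd 1 \<Longrightarrow> \<not> x + y dvd 1"
    and one: "mat 1 \<in> H" and mult: "\<And>A B. A \<in> H \<Longrightarrow> B \<in> H \<Longrightarrow> A ** B \<in> H"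
    and transvec: "\<And>v c. unimodular v \<Longrightarrow> transvec v c \<in> H"
    and "g \<in> carrier Sp"
  shows "g \<in> H"
proof -
  have cancel: "g \<in> H" if "transvec v c ** g \<in> H" "unimodular v" for v c g
  proof -
    have "transvec v (- c) ** (transvec v c ** g) = g"
      by (simp add: matrix_mul_assoc transvec_add transvec_0)
    then show ?thesis using mult[OF transvec[OF that(2)] that(1)] by metis
  qed
  have move: "\<exists>c. (transvec (y - g *v x) c ** g) *v x = y
      \<and> (\<forall>u. g *v u = u \<longrightarrow> sympl_form y u = sympl_form (g *v x) u \<longrightarrow> (transvec (y - g *v x) c ** g) *v u = u)
      \<and> transvec (y - g *v x) c ** g \<in> carrier Sp
      \<and> (transvec (y - g *v x) c ** g \<in> H \<longrightarrow> g \<in> H)"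
    if xy: "sympl_form (g *v x) y dvd 1" and g: "g \<in> carrier Sp" for g x y
  proof -
    obtain c where "transvec (y - g *v x) c *v (g *v x) = y"
      using transvec_move[OF xy] by blast
    moreover have "transvec (y - g *v x) c *v u = u" if "sympl_form y u = sympl_form (g *v x) u" for u
      using that by (intro transvec_fixes) (simp add: sympl_form_left_diff)
    ultimately show ?thesis
      using cancel unimodular_diff[OF xy] Sp_mult[OF transvec_Sp g]
      by (intro exI[of _ c]) (auto simp flip: matrix_vector_mul_assoc)
  qed
  have two_moves: "\<exists>g'\<in>carrier Sp. (g' \<in> H \<longrightarrow> g \<in> H) \<and> g' *v x = y \<and>
      (\<forall>u. g *v u = u \<longrightarrow> sympl_form z u = sympl_form (g *v x) u \<longrightarrow> sympl_form y u = sympl_form (g *v x) u \<longrightarrow> g' *v u = u)"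
    if g: "g \<in> carrier Sp" and z: "sympl_form (g *v x) z dvd 1" "sympl_form z y dvd 1" for g x y z
  proof -
    obtain c where c: "(transvec (z - g *v x) c ** g) *v x = z"
      "\<forall>u. g *v u = u \<longrightarrow> sympl_form z u = sympl_form (g *v x) u \<longrightarrow> (transvec (z - g *v x) c ** g) *v u = u"
      "transvec (z - g *v x) c ** g \<in> carrier Sp" "transvec (z - g *v x) c ** g \<in> H \<longrightarrow> g \<in> H"
      using move[OF z(1) g] by blast
    define h where "h = transvec (z - g *v x) c ** g"
    note h = c[folded h_def]
    have "sympl_form (h *v x) y dvd 1" using h(1) z(2) by simp
    from move[OF this h(3)] obtain d where d: "(transvec (y - h *v x) d ** h) *v x = y"
      "\<forall>u. h *v u = u \<longrightarrow> sympl_form y u = sympl_form (h *v x) u \<longrightarrow> (transvec (y - h *v x) d ** h) *v u = u"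
      "transvec (y - h *v x) d ** h \<in> carrier Sp" "transvec (y - h *v x) d ** h \<in> H \<longrightarrow> h \<in> H"
      by blast
    then show ?thesis
      using h by (intro bexI[of _ "transvec (y - h *v x) d ** h"]) auto
  qed
  have "g \<in> H"
    if "finite C" "g \<in> carrier Sp" "\<And>i. i \<notin> C \<Longrightarrow> g *v basis_e i = basis_e i \<and> g *v basis_f i = basis_f i"
    for C g
    using that
  proof (induction C arbitrary: g rule: finite_induct)
    case empty
    then show ?case using fixes_bases_imp_one[of g] one by simp
  next
    case (insert i C)
    note gSp = insert.prems(1) and fixed = insert.prems(2)
    have orth: "sympl_form (g *v x) u = sympl_form x u" if "g *v u = u" for x u
      using gSp that unfolding Sp_iff_preserves_symp by metis
    have g_ef: "sympl_form (g *v basis_e i) (g *v basis_f i) = 1"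
      using gSp by (simp add: Sp_iff_preserves_symp sympl_form_basis)
    have "\<exists>z\<in>{g *v basis_f i, basis_f i, g *v basis_f i + basis_f i}.
        sympl_form (g *v basis_e i) z dvd 1 \<and> sympl_form z (basis_e i) dvd 1"
      by (rule common_partner[OF local]) (simp_all add: g_ef sympl_form_basis)
    then obtain z where z: "z \<in> {g *v basis_f i, basis_f i, g *v basis_f i + basis_f i}"
      "sympl_form (g *v basis_e i) z dvd 1" "sympl_form z (basis_e i) dvd 1"
      by blast
    from two_moves[OF gSp z(2,3)] obtain g1 where g1: "g1 \<in> carrier Sp" "g1 \<in> H \<longrightarrow> g \<in> H" "g1 *v basis_e i = basis_e i"
      "\<forall>u. g *v u = u \<longrightarrow> sympl_form z u = sympl_form (g *v basis_e i) u \<longrightarrow> sympl_form (basis_e i) u = sympl_form (g *v basis_e i) u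
        \<longrightarrow> g1 *v u = u"
      by (elim bexE conjE) (rule that)
    have g1_fixed: "g1 *v basis_e l = basis_e l \<and> g1 *v basis_f l = basis_f l" if l: "l \<notin> insert i C" for l
    proof -
      have u: "g *v basis_e l = basis_e l" "g *v basis_f l = basis_f l"
        using fixed[OF l] by auto
      have "l \<noteq> i" using l by blast
      then have "sympl_form z (basis_e l) = 0" "sympl_form z (basis_f l) = 0"
        using z(1) orth[OF u(1)] orth[OF u(2)] by (auto simp: sympl_form_basis sympl_form_left_add)
      then show ?thesis
        using g1(4) u orth[OF u(1)] orth[OF u(2)] \<open>l \<noteq> i\<close> by (auto simp: sympl_form_basis)
    qed
    have g1_orth: "sympl_form (g1 *v x) u = sympl_form x u" if "g1 *v u = u" for x u
      using g1(1) that unfolding Sp_iff_preserves_symp by metis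
    have e_f': "sympl_form (g1 *v basis_f i) (basis_e i) = - 1"
      using g1_orth[OF g1(3)] by (simp add: sympl_form_basis)
    \<comment> \<open>If the image of \<open>basis_f i\<close> pairs to a non-unit with \<open>basis_f i\<close>, the detour through
      \<open>basis_f i + basis_e i\<close> works and has the right pairing with \<open>basis_e i\<close>.\<close>
    have "\<exists>z\<in>{g1 *v basis_f i, basis_f i + basis_e i}. sympl_form (g1 *v basis_f i) z dvd 1 \<and> sympl_form z (basis_f i) dvd 1
        \<or> sympl_form (g1 *v basis_f i) (basis_f i) dvd 1"
    proof (cases "sympl_form (g1 *v basis_f i) (basis_f i) dvd 1")
      case False
      have "\<not> \<not> sympl_form (g1 *v basis_f i) (basis_f i) + (- 1) dvd 1"
      proof
        assume n: "\<not> sympl_form (g1 *v basis_f i) (basis_f i) + (- 1) dvd 1"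
        have "\<not> (sympl_form (g1 *v basis_f i) (basis_f i) + (- 1)) + (- sympl_form (g1 *v basis_f i) (basis_f i)) dvd 1"
          by (rule local[OF n]) (use False in simp)
        then show False by simp
      qed
      then show ?thesis
        by (intro bexI[of _ "basis_f i + basis_e i"])
          (auto simp: sympl_form_right_add sympl_form_left_add sympl_form_basis e_f')
    qed blast
    then have "\<exists>g2\<in>carrier Sp. (g2 \<in> H \<longrightarrow> g1 \<in> H) \<and> g2 *v basis_f i = basis_f i \<and>
        (\<forall>u. g1 *v u = u \<longrightarrow> sympl_form (basis_e i) u = 0 \<longrightarrow> sympl_form (basis_f i) u = sympl_form (g1 *v basis_f i) u \<longrightarrow> g2 *v u = u)"
    proof (elim bexE disjE conjE)
      fix z
      assume "z \<in> {g1 *v basis_f i, basis_f i + basis_e i}"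
        and "sympl_form (g1 *v basis_f i) z dvd 1" "sympl_form z (basis_f i) dvd 1"
      then show ?thesis
        using two_moves[OF g1(1), of "basis_f i" z "basis_f i"] by (auto simp: sympl_form_left_add)
    next
      assume "sympl_form (g1 *v basis_f i) (basis_f i) dvd 1"
      from move[OF this g1(1)] show ?thesis by blast
    qed
    then obtain g2 where g2: "g2 \<in> carrier Sp" "g2 \<in> H \<longrightarrow> g1 \<in> H" "g2 *v basis_f i = basis_f i"
      "\<forall>u. g1 *v u = u \<longrightarrow> sympl_form (basis_e i) u = 0 \<longrightarrow> sympl_form (basis_f i) u = sympl_form (g1 *v basis_f i) u \<longrightarrow> g2 *v u = u"
      by (elim bexE conjE) (rule that)
    have "g2 \<in> H"
    proof (rule insert.IH[OF g2(1)])
      fix l assume "l \<notin> C"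
      show "g2 *v basis_e l = basis_e l \<and> g2 *v basis_f l = basis_f l"
      proof (cases "l = i")
        case True
        then show ?thesis
          using g2(3,4) g1(3) e_f' by (simp add: sympl_form_basis)
      next
        case False
        with \<open>l \<notin> C\<close> have u: "g1 *v basis_e l = basis_e l" "g1 *v basis_f l = basis_f l"
          using g1_fixed[of l] by auto
        then show ?thesis
          using g2(4) False g1_orth[OF u(1)] g1_orth[OF u(2)] by (auto simp: sympl_form_basis)
      qed
    qed
    then show ?case using g2(2) g1(2) by blast
  qed
  from this[of UNIV g] assms(5) show ?thesis by simp
qed

section \<open>Representations of the symplectic group\<close>

definition blockmat :: "'a::comm_ring_1 ^ 'k ^ 'k \<Rightarrow> 'a ^ 'k ^ 'k \<Rightarrow> 'a ^ 'k ^ 'k \<Rightarrow> 'a ^ 'k ^ 'k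
    \<Rightarrow> 'a ^ ('k::finite + 'k) ^ ('k + 'k)" where
  "blockmat A B C D = (\<chi> i j. case (i, j) of (Inl a, Inl b) \<Rightarrow> A $ a $ b | (Inl a, Inr b) \<Rightarrow> B $ a $ b
    | (Inr a, Inl b) \<Rightarrow> C $ a $ b | (Inr a, Inr b) \<Rightarrow> D $ a $ b)"

lemma blockmat_mult_stack: "blockmat A B C D *v stack u w = stack (A *v u + B *v w) (C *v u + D *v w)"
  by (simp add: vec_sum_eq_iff matrix_vector_mult_def sum_over_sum_type blockmat_def)

definition upper :: "'a::comm_ring_1 ^ 'k ^ 'k \<Rightarrow> 'a ^ ('k::finite + 'k) ^ ('k + 'k)" where
  "upper B = blockmat (mat 1) B 0 (mat 1)"

text \<open>Meant for an invertible \<open>A\<close> with inverse \<open>A'\<close>; the Levi factor of the Siegel parabolic subgroup.\<close>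

definition levi :: "'a::comm_ring_1 ^ 'k ^ 'k \<Rightarrow> 'a ^ 'k ^ 'k \<Rightarrow> 'a ^ ('k::finite + 'k) ^ ('k + 'k)" where
  "levi A A' = blockmat A 0 0 (transpose A')"

lemma upper_mult_stack: "upper B *v stack u w = stack (u + B *v w) w"
  by (simp add: upper_def blockmat_mult_stack)

lemma levi_mult_stack: "levi A A' *v stack u w = stack (A *v u) (transpose A' *v w)"
  by (simp add: levi_def blockmat_mult_stack)

lemma matrix_eq_stack:
  fixes A B :: "'a::comm_ring_1 ^ ('k::finite + 'k) ^ ('k + 'k)"
  assumes "\<And>u w. A *v stack u w = B *v stack u w"
  shows "A = B"
  by (rule matrix_eq_vec) (metis assms stack_cases)

lemma upper_add: "upper (B + C) = upper B ** upper C"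
  by (rule matrix_eq_stack)
    (simp add: upper_mult_stack matrix_vector_mult_add_rdistrib add_ac flip: matrix_vector_mul_assoc)

lemma upper_0: "upper 0 = mat 1"
  by (rule matrix_eq_stack) (simp add: upper_mult_stack)

lemma upper_Sp:
  fixes B :: "'a::comm_ring_1 ^ 'k::finite ^ 'k"
  assumes "transpose B = B"
  shows "upper B \<in> carrier Sp"
  unfolding Sp_iff_preserves_symp
proof (intro conjI allI)
  show "invertible (upper B)"
    unfolding invertible_def
    by (rule exI[of _ "upper (- B)"]) (simp add: upper_0 flip: upper_add)
  fix x y :: "'a ^ ('k + 'k)"
  obtain u w u' w' where "x = stack u w" "y = stack u' w'" by (metis stack_cases)
  then show "sympl_form (upper B *v x) (upper B *v y) = sympl_form x y"
    using dot_matrix_vector[of w B w'] assms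
    by (simp add: upper_mult_stack sympl_form_stack dot_add_right dot_commute[of "_ + _"])
      (simp add: dot_commute)
qed

lemma levi_Sp:
  fixes A A' :: "'a::comm_ring_1 ^ 'k::finite ^ 'k"
  assumes "A ** A' = mat 1" "A' ** A = mat 1"
  shows "levi A A' \<in> carrier Sp"
  unfolding Sp_iff_preserves_symp
proof (intro conjI allI)
  have T: "transpose A' ** transpose A = mat 1" "transpose A ** transpose A' = mat 1"
    using assms by (simp_all flip: matrix_transpose_mul)
  show "invertible (levi A A')"
    unfolding invertible_def
    by (rule exI[of _ "levi A' A"], intro conjI; rule matrix_eq_stack)
      (simp_all add: levi_mult_stack matrix_vector_mul_assoc assms T flip: matrix_vector_mul_assoc[of "levi _ _"])
  have *: "dot (A *v u) (transpose A' *v w) = dot u w" for u w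
    by (subst dot_matrix_vector) (simp add: matrix_vector_mul_assoc assms)
  fix x y :: "'a ^ ('k + 'k)"
  obtain u w u' w' where "x = stack u w" "y = stack u' w'" by (metis stack_cases)
  then show "sympl_form (levi A A' *v x) (levi A A' *v y) = sympl_form x y"
    by (simp add: levi_mult_stack sympl_form_stack * dot_commute[of "transpose A' *v _"]) (simp add: dot_commute)
qed

lemma levi_conj_upper:
  assumes "A' ** A = mat 1"
  shows "levi A A' ** upper B = upper (A ** B ** transpose A) ** levi A A'"
proof (rule matrix_eq_stack)
  fix u w
  have "transpose A *v (transpose A' *v w) = w"
    using assms by (metis matrix_transpose_mul matrix_vector_mul_assoc matrix_vector_mul_lid transpose_mat)
  then show "(levi A A' ** upper B) *v stack u w = (upper (A ** B ** transpose A) ** levi A A') *v stack u w"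
    by (simp add: levi_mult_stack upper_mult_stack matrix_vector_right_distrib flip: matrix_vector_mul_assoc)
qed

lemma upper_rank_one: "upper (\<chi> a b. c * v $ a * v $ b) = transvec (stack v 0) c"
proof (rule matrix_eq_stack)
  fix u w
  have "(\<chi> a b. c * v $ a * v $ b) *v w = (c * dot v w) *s v"
    by (simp add: vec_eq_iff matrix_vector_mult_def dot_def sum_distrib_left sum_distrib_right mult_ac)
  then show "upper (\<chi> a b. c * v $ a * v $ b) *v stack u w = transvec (stack v 0) c *v stack u w"
    by (simp add: upper_mult_stack transvec_mult_vec sympl_form_stack) (simp add: vec_sum_eq_iff)
qed

text \<open>
  The symmetric matrices supported on row and column \<open>i0\<close>. Among all symmetric matrices \<open>B\<close> they
  form a subgroup that \<open>B \<mapsto> A B A\<^sup>T\<close> preserves when \<open>A\<close> is a diagonal matrix or adds a multiple of some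
  row to row \<open>i0\<close>. Unlike the full space of symmetric matrices, it is indexed by vectors.
\<close>

definition cross :: "'k \<Rightarrow> 'a::comm_ring_1 ^ 'k \<Rightarrow> 'a ^ 'k ^ 'k" where
  "cross i0 u = (\<chi> a b. if a = i0 then u $ b else if b = i0 then u $ a else 0)"

lemma transpose_cross: "transpose (cross i0 u) = cross i0 u"
  by (simp add: transpose_def cross_def vec_eq_iff)

lemma cross_add: "cross i0 (u + v) = cross i0 u + cross i0 v"
  by (simp add: cross_def vec_eq_iff)

lemma cross_0: "cross i0 0 = 0"
  by (simp add: cross_def vec_eq_iff)

lemma cross_axis_self: "cross i0 (axis i0 c) = (\<chi> a b. c * axis i0 1 $ a * axis i0 1 $ b)"
  by (auto simp: cross_def vec_eq_iff axis_def)

text \<open>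
  Polarisation: the mixed symmetric product of two vectors is a combination of three squares. It
  reduces triviality on all of \<open>cross\<close> to triviality on transvections.
\<close>

lemma cross_axis_other:
  assumes "j \<noteq> i0"
  shows "cross i0 (axis j c) = (\<chi> a b. c * (axis i0 1 + axis j 1) $ a * (axis i0 1 + axis j 1) $ b)
    + ((\<chi> a b. (- c) * axis i0 1 $ a * axis i0 1 $ b) + (\<chi> a b. (- c) * axis j 1 $ a * axis j 1 $ b))"
  using assms by (auto simp: cross_def vec_eq_iff axis_def)

lemma cross_conj_elementary:
  assumes "i0 \<noteq> j"
  shows "colmat j (axis i0 c) ** cross i0 u ** transpose (colmat j (axis i0 c))
    = cross i0 (u + axis i0 ((c + c) * u $ j))"
  unfolding rowmat_def[symmetric] using assms
  by (simp add: vec_eq_iff mult_rowmat_nth colmat_mult_nth)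
    (auto simp: cross_def axis_def algebra_simps)

lemma cross_conj_diagmat:
  assumes "\<And>l. d $ l = (if l = i0 then t else 1)"
  shows "diagmat d ** cross i0 u ** transpose (diagmat d)
    = cross i0 (\<chi> l. (if l = i0 then t * t else t) * u $ l)"
proof -
  have "transpose (diagmat d) = diagmat d"
    by (auto simp: transpose_def diagmat_def vec_eq_iff)
  then show ?thesis
    unfolding vec_eq_iff[of "_ ** _"] by (simp add: vec_eq_iff[of "(_ ** _) $ _"] diagmat_mult_nth mult_diagmat_nth)
      (simp add: assms cross_def mult_ac)
qed

lemma two_mod_ring_nonzero:
  assumes "CARD('p::prime_card) \<ge> 3"
  shows "(2 :: 'p mod_ring) \<noteq> 0"
proof
  assume "(2 :: 'p mod_ring) = 0"
  then have "CARD('p) dvd 2"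
    using of_nat_0_mod_ring_dvd[of 2, where 'a = 'p] by simp
  then show False using assms by (auto dest: dvd_imp_le)
qed

text \<open>
  The distinguished coordinate is the one at \<open>i0\<close>, which belongs to transvections along \<open>basis_e i0\<close>.
  Some element of the spectrum is non-zero there: all unimodular transvections with the same parameter
  are conjugate, so if the representation were trivial on those along \<open>basis_e i0\<close> with parameter in
  \<open>pideal n\<close>, polarisation would make the whole layer trivial. Conjugacy also shows that the
  representation is not trivial on the whole subgroup, as otherwise all generators would act trivially.

  Conjugation by an elementary matrix adds twice a multiple of coordinate \<open>j\<close> to coordinate \<open>i0\<close>;
  the factor \<open>2\<close> is a unit as \<open>p\<close> is odd. Conjugation by a diagonal matrix multiplies coordinate \<open>i0\<close> by
  a square.
\<close>

theorem Sp_degree: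
  fixes \<rho> :: "'p::prime_card padic_int ^ ('k::finite + 'k) ^ ('k + 'k) \<Rightarrow> complex ^ 'd ^ 'd"
  assumes cont: "continuous_representation Sp \<rho>" and nontriv: "nontrivial_representation Sp \<rho>"
    and p: "CARD('p) \<ge> 3"
  shows "(CARD('p) - 1) * CARD('p) ^ (CARD('k) - 1) \<le> 2 * CARD('d)"
proof -
  have hom: "\<rho> \<in> hom Sp GL"
    using cont by (simp add: continuous_representation_def)
  have \<rho>_mult: "\<rho> (A ** B) = \<rho> A ** \<rho> B" if "A \<in> carrier Sp" "B \<in> carrier Sp" for A B
    using hom that by (auto simp: hom_def Sp_simps GL_def)
  have \<rho>_inv: "invertible (\<rho> A)" if "A \<in> carrier Sp" for A
    using hom_GL_invertible[OF hom that] .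
  have \<rho>_1: "\<rho> (mat 1) = mat 1"
    by (rule representation_one[OF hom Sp_one]) (simp add: Sp_simps)
  \<comment> \<open>The distinguished index is arbitrary.\<close>
  obtain i0 :: 'k where True by simp
  let ?e = "stack (axis i0 1) 0 :: 'p padic_int ^ ('k + 'k)"
  have unimod_stack: "unimodular (stack v 0)" if "v $ i = 1" for v :: "'p padic_int ^ 'k" and i
    unfolding unimodular_def
    by (rule exI[of _ "stack 0 (axis i 1)"]) (simp add: sympl_form_stack dot_axis that)
  have all_transvec: "\<rho> (transvec v c) = mat 1" if e: "\<rho> (transvec ?e c) = mat 1" and v: "unimodular v" for v c
  proof -
    have "unimodular ?e" by (rule unimod_stack[of _ i0]) simp
    then obtain g where g: "g \<in> carrier Sp" "g *v ?e = v"
      using Sp_transitive_unimodular[OF nonunit_padic_add _ v] by blast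
    have "\<rho> g ** \<rho> (transvec ?e c) = \<rho> (transvec v c) ** \<rho> g"
      using transvec_conj[OF g(1), of ?e c] g by (simp add: transvec_Sp flip: \<rho>_mult)
    moreover obtain R where "\<rho> g ** R = mat 1"
      using \<rho>_inv[OF g(1)] unfolding invertible_def by blast
    ultimately show ?thesis
      using e by (metis matrix_mul_assoc matrix_mul_rid)
  qed
  define \<Phi> where "\<Phi> u = \<rho> (upper (cross i0 u))" for u
  have upper_cross_Sp: "upper (cross i0 u) \<in> carrier Sp" for u :: "'p padic_int ^ 'k"
    by (rule upper_Sp) (rule transpose_cross)
  have rank_one_Sp: "upper (\<chi> a b. c * v $ a * v $ b) \<in> carrier Sp" for c and v :: "'p padic_int ^ 'k"
    unfolding upper_rank_one by (rule transvec_Sp)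
  interpret padic_hom \<Phi>
    by unfold_locales (simp_all add: \<Phi>_def cross_0 upper_0 \<rho>_1 cross_add upper_add \<rho>_mult upper_cross_Sp)
  have \<Phi>_self: "\<Phi> (axis i0 c) = \<rho> (transvec ?e c)" for c
    by (simp only: \<Phi>_def cross_axis_self upper_rank_one)
  have \<Phi>_level: "\<Phi> u = mat 1"
    if long: "\<And>z. z \<in> pideal n \<Longrightarrow> \<Phi> (axis i0 z) = mat 1" and u: "\<And>i. u $ i \<in> pideal n" for u n
  proof -
    have rank_one: "\<rho> (upper (\<chi> a b. c * v $ a * v $ b)) = mat 1"
      if "c \<in> pideal n" "v $ i = 1" for c i and v :: "'p padic_int ^ 'k"
    proof -
      have "\<rho> (transvec ?e c) = mat 1"
        using long[OF that(1)] by (simp only: \<Phi>_self)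
      then show ?thesis
        unfolding upper_rank_one by (rule all_transvec) (rule unimod_stack[OF that(2)])
    qed
    have axis: "\<Phi> (axis j c) = mat 1" if "c \<in> pideal n" for j c
    proof (cases "j = i0")
      case True
      then show ?thesis using long[OF that] by simp
    next
      case False
      have "\<rho> (upper (\<chi> a b. c * (axis i0 1 + axis j 1) $ a * (axis i0 1 + axis j 1) $ b)) = mat 1"
        by (rule rank_one[of _ _ i0]) (use that False in \<open>auto simp: axis_def\<close>)
      moreover have "\<rho> (upper (\<chi> a b. (- c) * axis i0 1 $ a * axis i0 1 $ b)) = mat 1"
        by (rule rank_one[of _ _ i0]) (use that in \<open>auto simp: pideal_uminus\<close>)
      moreover have "\<rho> (upper (\<chi> a b. (- c) * axis j 1 $ a * axis j 1 $ b)) = mat 1"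
        by (rule rank_one[of _ _ j]) (use that in \<open>auto simp: pideal_uminus\<close>)
      ultimately show ?thesis
        unfolding \<Phi>_def cross_axis_other[OF False] upper_add
        by (simp only: \<rho>_mult Sp_mult rank_one_Sp matrix_mul_lid)
    qed
    have "\<Phi> (\<Sum>i\<in>A. axis i (u $ i)) = mat 1" for A
      by (induction A rule: infinite_finite_induct) (simp_all add: \<Phi>_0 \<Phi>_add axis u)
    from this[of UNIV] show ?thesis by (simp flip: vec_eq_sum_axis)
  qed
  have "\<exists>u0. \<Phi> u0 \<noteq> mat 1"
  proof (rule ccontr)
    assume "\<not> ?thesis"
    then have "\<rho> (transvec v c) = mat 1" if "unimodular v" for v c
      using all_transvec[OF _ that] \<Phi>_self by metis
    then have "A \<in> {A \<in> carrier Sp. \<rho> A = mat 1}" if "A \<in> carrier Sp" for A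
      by (intro Sp_generated_by_transvections[OF nonunit_padic_add _ _ _ that])
        (simp_all add: \<rho>_1 Sp_one Sp_mult \<rho>_mult transvec_Sp)
    then show False
      using nontriv by (auto simp: nontrivial_representation_def)
  qed
  then obtain u0 where u0: "\<Phi> u0 \<noteq> mat 1" by blast
  obtain N where N: "\<And>A. A \<in> carrier Sp \<Longrightarrow> (\<forall>i j. A $ i $ j - mat 1 $ i $ j \<in> pideal N) \<Longrightarrow> mnorm (\<rho> A - mat 1) \<le> 1 / 2"
    using continuous_representation_near_one[OF cont Sp_one \<rho>_1] by blast
  have small: "mnorm (\<Phi> u - mat 1) \<le> 1 / 2" if "\<forall>i. u $ i \<in> pideal N" for u
    unfolding \<Phi>_def
  proof (rule N[OF upper_cross_Sp], intro allI)
    fix i j :: "'k + 'k"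
    show "upper (cross i0 u) $ i $ j - mat 1 $ i $ j \<in> pideal N"
      using that by (cases i; cases j) (auto simp: upper_def blockmat_def mat_def cross_def)
  qed
  with exact_level[of u0] u0 obtain n u1 where
    triv: "\<And>u. (\<forall>i. u $ i \<in> pideal (Suc n)) \<Longrightarrow> \<Phi> u = mat 1"
    and rep: "elementary_rep (\<lambda>v. \<Phi> (lift_digit n v))"
    and u1: "\<forall>i. u1 $ i \<in> pideal n" "\<Phi> u1 \<noteq> mat 1"
    by blast
  define S where "S = elementary_rep.spectrum (\<lambda>v. \<Phi> (lift_digit n v))"
  have card_S: "card S \<le> CARD('d)"
    unfolding S_def by (rule elementary_rep.card_spectrum_le[OF rep])
  have "\<exists>a\<in>S. a $ i0 \<noteq> 0"
  proof -
    obtain z where z: "z \<in> pideal n" "\<Phi> (axis i0 z) \<noteq> mat 1"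
      using \<Phi>_level[of n u1] u1 by blast
    obtain x where x: "z - digit n x \<in> pideal (Suc n)"
      using ex_digit[OF z(1)] by blast
    have "\<Phi> (axis i0 z) = \<Phi> (lift_digit n (axis i0 x))"
      unfolding lift_digit_axis by (rule \<Phi>_cong[OF triv]) (use x in \<open>auto simp: axis_def\<close>)
    with z(2) have "\<Phi> (lift_digit n (axis i0 x)) \<noteq> mat 1" by simp
    from elementary_rep.spectrum_detects[OF rep this]
    show ?thesis unfolding S_def by (auto simp: dot_axis)
  qed
  then obtain a where a: "a \<in> S" "a $ i0 \<noteq> 0" by blast
  have intertwine: "\<rho> (levi A A') ** \<Phi> u = \<Phi> u' ** \<rho> (levi A A')"
    if AA': "A ** A' = mat 1" "A' ** A = mat 1" and u': "A ** cross i0 u ** transpose A = cross i0 u'"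
    for A A' and u u' :: "'p padic_int ^ 'k"
    using levi_conj_upper[OF AA'(2), of "cross i0 u"]
    unfolding \<Phi>_def u' by (simp add: levi_Sp[OF AA'] upper_cross_Sp flip: \<rho>_mult)
  have shear: "b + axis j c \<in> S" if b: "b \<in> S" "b $ i0 \<noteq> 0" and j: "j \<noteq> i0" for b j c
  proof -
    define s where "s = - c / (2 * b $ i0)"
    define q :: "'p padic_int" where "q = digit 0 s"
    let ?A = "\<lambda>x :: 'p padic_int. colmat j (axis i0 x)"
    have AA: "?A x ** ?A (- x) = mat 1" for x
    proof -
      have "axis i0 x + axis i0 (- x) = (0 :: 'p padic_int ^ 'k)"
        by (simp add: vec_eq_iff axis_def)
      then show ?thesis by (simp add: colmat_0 flip: colmat_add)
    qed
    have AA': "?A (- q) ** ?A q = mat 1"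
      using AA[of "- q"] by simp
    let ?D = "levi (?A q) (?A (- q))"
    have "b - axis j ((s + s) * b $ i0) \<in> S"
      unfolding S_def
    proof (rule level_spectrum_shear[OF triv rep])
      show "b \<in> elementary_rep.spectrum (\<lambda>v. \<Phi> (lift_digit n v))"
        using b by (simp add: S_def)
      show "reduces_to n (q + q) (s + s)"
        unfolding q_def by (intro reduces_to_add reduces_to_digit)
      show "invertible (\<rho> ?D)" by (rule \<rho>_inv[OF levi_Sp[OF AA AA']])
      show "\<rho> ?D ** \<Phi> u = \<Phi> (u + axis i0 ((q + q) * u $ j)) ** \<rho> ?D" for u
        by (rule intertwine[OF AA AA']) (rule cross_conj_elementary, use j in simp)
    qed (use j in auto)
    moreover have "(s + s) * b $ i0 = - c"
      using b(2) two_mod_ring_nonzero[OF p] by (simp add: s_def flip: mult_2)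
    then have "b - axis j ((s + s) * b $ i0) = b + axis j c"
      by (simp add: vec_eq_iff axis_def)
    ultimately show ?thesis by (simp only:)
  qed
  have scale: "\<exists>b\<in>S. b $ i0 = t * t * a $ i0" if t: "t \<noteq> 0" for t
  proof -
    obtain e where e: "1 = digit 0 (1 / t) * e"
      using digit_unit[of "1 / t"] t by (auto elim: dvdE)
    define d :: "'p padic_int ^ 'k" where "d = (\<chi> l. if l = i0 then digit 0 (1 / t) else 1)"
    define d' :: "'p padic_int ^ 'k" where "d' = (\<chi> l. if l = i0 then e else 1)"
    define s where "s l = (if l = i0 then 1 / t * (1 / t) else 1 / t)" for l
    have dd: "diagmat d ** diagmat d' = mat 1" "diagmat d' ** diagmat d = mat 1"
      using e by (auto simp: vec_eq_iff diagmat_mult_nth) (auto simp: diagmat_def d_def d'_def mat_def mult.commute)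
    have "(\<chi> l. a $ l / s l) \<in> S"
      unfolding S_def
    proof (rule level_spectrum_scale[OF triv rep])
      show "a \<in> elementary_rep.spectrum (\<lambda>v. \<Phi> (lift_digit n v))"
        using a by (simp add: S_def)
      show "s l \<noteq> 0" for l using t by (simp add: s_def)
      show "reduces_to n (if l = i0 then digit 0 (1 / t) * digit 0 (1 / t) else digit 0 (1 / t)) (s l)" for l
        by (simp add: s_def reduces_to_digit reduces_to_mult del: times_divide_eq_right times_divide_eq_left)
      show "invertible (\<rho> (levi (diagmat d) (diagmat d')))" by (rule \<rho>_inv[OF levi_Sp[OF dd]])
      show "\<rho> (levi (diagmat d) (diagmat d')) ** \<Phi> u
          = \<Phi> (\<chi> l. (if l = i0 then digit 0 (1 / t) * digit 0 (1 / t) else digit 0 (1 / t)) * u $ l)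
            ** \<rho> (levi (diagmat d) (diagmat d'))" for u
        by (rule intertwine[OF dd]) (rule cross_conj_diagmat, simp add: d_def)
    qed
    then show ?thesis
      by (rule bexI[rotated]) (use t in \<open>simp add: s_def\<close>)
  qed
  let ?W = "{t * t * a $ i0 |t. t \<noteq> 0}"
  have W: "?W \<subseteq> (\<lambda>b. b $ i0) ` S - {0}"
    using scale a(2) by force
  have "card ?W * CARD('p mod_ring) ^ card (UNIV - {i0}) \<le> card S"
    by (rule card_ge_of_shears[OF _ _ W]) (auto intro: shear)
  then have "card ?W * CARD('p) ^ (CARD('k) - 1) \<le> CARD('d)"
    using card_S by (simp add: card_Diff_singleton)
  moreover have "(CARD('p) - 1) * CARD('p) ^ (CARD('k) - 1) \<le> 2 * card ?W * CARD('p) ^ (CARD('k) - 1)"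
    by (rule mult_right_mono[OF card_square_multiples[OF a(2)]]) simp
  ultimately show ?thesis by linarith
qed

theorem theorem2:
  fixes p :: nat
  assumes "CARD('p::prime_card) = p" and "p \<ge> 3"
  shows
    "(\<forall>\<rho> :: 'p padic_int ^ 2 ^ 2 \<Rightarrow> complex ^ 'd ^ 'd.
        continuous_representation SL \<rho> \<longrightarrow> nontrivial_representation SL \<rho> \<longrightarrow>
        real CARD('d) \<ge> (real p - 1) / 2) \<and>
     (CARD('k::finite) \<ge> 3 \<longrightarrow> (\<forall>\<rho> :: 'p padic_int ^ 'k ^ 'k \<Rightarrow> complex ^ 'd ^ 'd.
        continuous_representation SL \<rho> \<longrightarrow> nontrivial_representation SL \<rho> \<longrightarrow>
        real CARD('d) \<ge> real p ^ (CARD('k) - 1) - real p ^ (CARD('k) - 2))) \<and>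
     (CARD('k::finite) \<ge> 2 \<longrightarrow> (\<forall>\<rho> :: 'p padic_int ^ ('k::finite + 'k) ^ ('k + 'k) \<Rightarrow> complex ^ 'd ^ 'd.
        continuous_representation Sp \<rho> \<longrightarrow> nontrivial_representation Sp \<rho> \<longrightarrow>
        real CARD('d) \<ge> (real p - 1) / 2 * real p ^ (CARD('k) - 1)))"
proof (intro conjI impI allI)
  have p1: "real (p - 1) = real p - 1" using assms(2) by simp
  show "real CARD('d) \<ge> (real p - 1) / 2"
    if "continuous_representation SL \<rho>" "nontrivial_representation SL \<rho>"
    for \<rho> :: "'p padic_int ^ 2 ^ 2 \<Rightarrow> complex ^ 'd ^ 'd"
  proof -
    have "real (p - 1) \<le> real (2 * CARD('d))"
      using SL_degree_torus[OF that] assms(1) by (simp only: of_nat_le_iff)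
    then show ?thesis by (simp add: p1)
  qed
  show "real CARD('d) \<ge> real p ^ (CARD('k) - 1) - real p ^ (CARD('k) - 2)"
    if "CARD('k) \<ge> 3" "continuous_representation SL \<rho>" "nontrivial_representation SL \<rho>"
    for \<rho> :: "'p padic_int ^ 'k ^ 'k \<Rightarrow> complex ^ 'd ^ 'd"
  proof -
    have "real ((p - 1) * p ^ (CARD('k) - 2)) \<le> real CARD('d)"
      using SL_degree[OF that] assms(1) by (simp only: of_nat_le_iff)
    then have "(real p - 1) * real p ^ (CARD('k) - 2) \<le> real CARD('d)"
      by (simp only: of_nat_mult of_nat_power p1)
    moreover have "CARD('k) - 1 = Suc (CARD('k) - 2)" using that(1) by simp
    ultimately show ?thesis by (simp add: p1 algebra_simps)
  qed
  show "real CARD('d) \<ge> (real p - 1) / 2 * real p ^ (CARD('k) - 1)"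
    if "continuous_representation Sp \<rho>" "nontrivial_representation Sp \<rho>"
    for \<rho> :: "'p padic_int ^ ('k + 'k) ^ ('k + 'k) \<Rightarrow> complex ^ 'd ^ 'd"
  proof -
    have "real ((p - 1) * p ^ (CARD('k) - 1)) \<le> real (2 * CARD('d))"
      using Sp_degree[OF that] assms by (simp only: of_nat_le_iff)
    then have "(real p - 1) * real p ^ (CARD('k) - 1) \<le> 2 * real CARD('d)"
      by (simp only: of_nat_mult of_nat_power of_nat_numeral p1)
    then show ?thesis by simp
  qed
qed

end
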